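(* Let $q=p^m$ with $p$ prime such that $3\mid\frac{q-1}{p-1}$ and $q\ge5$, and put $n=\frac{q-1}{3}$. Then $\Gamma(3,q)$ is connected with integral spectrum given as follows. (a) If $p\equiv1\pmod3$, then $m=3t$ for some $t\in\mathbb N$ and $$\mathrm{Spec}(\Gamma(3,q))=\Big\{[n]^1,\Big[\tfrac{a\sqrt[3]q-1}{3}\Big]^n,\Big[\tfrac{-\frac12(a+9b)\sqrt[3]q-1}{3}\Big]^n,\Big[\tfrac{-\frac12(a-9b)\sqrt[3]q-1}{3}\Big]^n\Big\},$$ where $a,b$ are integers (with $a$ unique, $b$ unique up to sign) determined by $4\sqrt[3]q=a^2+27b^2$, $a\equiv1\pmod3$, $\gcd(a,p)=1$. (b) If $p\equiv2\pmod3$, then $m=2t$ for some $t\in\mathbb N$ and $$\mathrm{Spec}(\Gamma(3,q))=\begin{cases}\{[n]^1,[\frac{\sqrt q-1}{3}]^{2n},[\frac{-2\sqrt q-1}{3}]^n\} & m\equiv0\pmod4,\\ \{[n]^1,[\frac{2\sqrt q-1}{3}]^{n},[\frac{-\sqrt q-1}{3}]^{2n}\} & m\equiv2\pmod4;\end{cases}$$ in particular $\Gamma(3,q)$ is strongly regular in this case.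
   Context: Let $p$ be prime, $q=p^m$, $R_3=\{x^3:x\in\mathbb F_q^*\}$, and $\Gamma(3,q)$ the Cayley graph on $\mathbb F_q$ in which $u\to v$ is an edge iff $v-u\in R_3$. Spectrum = multiset of adjacency eigenvalues, written $\{[\lambda]^{\text{mult}}\}$. *)

theory Defs
  imports "HOL-Analysis.Analysis" "HOL-Computational_Algebra.Polynomial" "HOL-Library.Multiset"
begin

definition cubes :: "'a::field set" where
  "cubes = {x ^ 3 | x. x \<noteq> 0}"

definition cayley3 :: "'a::{field,finite} \<Rightarrow> 'a \<Rightarrow> bool" where
  "cayley3 u v \<longleftrightarrow> v - u \<in> cubes"

definition adj_matrix :: "('a::finite \<Rightarrow> 'a \<Rightarrow> bool) \<Rightarrow> real ^'a ^'a" where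
  "adj_matrix E = (\<chi> u v. if E u v then 1 else 0)"

definition charpoly :: "real ^'n ^'n \<Rightarrow> real poly" where
  "charpoly A = det (\<chi> i j. (if i = j then [:0, 1:] else 0) - [:A $ i $ j:])"

text \<open>M is the spectrum (multiset of eigenvalues, with algebraic multiplicity) of A:
  the characteristic polynomial factors as the product of (x - lambda) over M.\<close>
definition is_spectrum :: "real ^'n ^'n \<Rightarrow> real multiset \<Rightarrow> bool" where
  "is_spectrum A M \<longleftrightarrow> charpoly A = prod_mset (image_mset (\<lambda>l. [:-l, 1:]) M)"

definition graph_connected :: "('a \<Rightarrow> 'a \<Rightarrow> bool) \<Rightarrow> bool" where
  "graph_connected E \<longleftrightarrow> (\<forall>u v. E\<^sup>*\<^sup>* u v)"

definition strongly_regular :: "('a::finite \<Rightarrow> 'a \<Rightarrow> bool) \<Rightarrow> bool" where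
  "strongly_regular E \<longleftrightarrow>
     (\<forall>u v. E u v \<longleftrightarrow> E v u) \<and> (\<forall>u. \<not> E u u) \<and>
     (\<exists>k l m. (\<forall>u. card {w. E u w} = k) \<and>
        (\<forall>u v. E u v \<longrightarrow> card {w. E u w \<and> E v w} = l) \<and>
        (\<forall>u v. u \<noteq> v \<and> \<not> E u v \<longrightarrow> card {w. E u w \<and> E v w} = m))"

end

theory Submission
  imports Defs "HOL-Number_Theory.Residues"
begin

text \<open>
  The eigenvalues of the graph are the cubic periods \<open>\<eta>(b) = \<Sum>\<^bsub>x\<in>R\<^esub> \<psi>(b x)\<close>, with \<open>\<psi>\<close> a nontrivial additive
  character. The divisibility hypothesis says that the nonzero elements of the prime field are cubes,
  which makes every period an integer. For \<open>b \<noteq> 0\<close> the numbers \<open>\<theta> = 3 \<eta> + 1\<close> take three values, each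
  1 modulo 3, and counting solutions of \<open>x\<^sup>3 + y\<^sup>3 = 0\<close> and \<open>x\<^sup>3 + y\<^sup>3 + z\<^sup>3 = 0\<close> shows that these three have sum 0,
  square sum \<open>6q\<close> and product \<open>q c\<close> for an integer \<open>c\<close>.

  If \<open>p \<equiv> 2\<close> (mod 3), then \<open>p\<close> is inert for the form \<open>x\<^sup>2 + xy + y\<^sup>2\<close>, and the first two relations force the
  values \<open>\<plusminus>\<surd>q (1, 1, -2)\<close>. If \<open>p \<equiv> 1\<close> (mod 3), then \<open>c\<close> is congruent to minus the central binomial
  coefficient \<open>2n choose n\<close>, which is prime to \<open>p\<close>; a descent then removes exactly the factor \<open>q\<^bsup>1/3\<^esup>\<close> from
  all three values, and the cofactors are read off from a representation \<open>4 q\<^bsup>1/3\<^esup> = a\<^sup>2 + 27 b\<^sup>2\<close>.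
\<close>

section \<open>Integer triples and the forms \<open>x\<^sup>2 + xy + y\<^sup>2\<close> and \<open>x\<^sup>2 + 27y\<^sup>2\<close>\<close>

lemma fermat_theorem_int:
  fixes x :: int and p :: nat
  assumes "prime p" "\<not> int p dvd x"
  shows "[x ^ (p - 1) = 1] (mod int p)"
proof -
  have p0: "int p > 0" using assms(1) prime_gt_0_nat by auto
  define a where "a = nat (x mod int p)"
  have a: "int a = x mod int p" using p0 by (simp add: a_def)
  have "\<not> p dvd a"
    using assms(2) a by (metis dvd_mod_iff dvd_refl int_dvd_int_iff)
  then have "[a ^ (p - 1) = 1] (mod p)" using fermat_theorem assms(1) by blast
  then have "[int a ^ (p - 1) = 1] (mod int p)"
    using cong_int_iff by (metis of_nat_1 of_nat_power)
  moreover have "[x ^ (p - 1) = int a ^ (p - 1)] (mod int p)"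
    by (intro cong_pow) (simp add: a cong_def)
  ultimately show ?thesis using cong_trans by blast
qed

text \<open>Cubing is injective modulo a prime \<open>p \<equiv> 2\<close> (mod 3), and \<open>(x - y)(x\<^sup>2 + xy + y\<^sup>2) = x\<^sup>3 - y\<^sup>3\<close>.\<close>

lemma prime_dvd_loeschian:
  fixes x y :: int and p :: nat
  assumes p: "prime p" "p mod 3 = 2" and dvd: "int p dvd x\<^sup>2 + x * y + y\<^sup>2"
  shows "int p dvd x \<and> int p dvd y"
proof (cases "int p dvd y")
  case True
  then have "int p dvd x * (x + y) + y\<^sup>2 - y\<^sup>2"
    using dvd by (intro dvd_diff) (auto simp: power2_eq_square algebra_simps)
  moreover have "int p dvd x" if "int p dvd x + y"
    using that True by (metis add_diff_cancel_right' dvd_diff)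
  ultimately show ?thesis
    using p(1) True prime_dvd_multD[of "int p" x "x + y"] by auto
next
  case False
  have pi: "prime (int p)" using p(1) by simp
  have x: "\<not> int p dvd x"
  proof
    assume x: "int p dvd x"
    then have "int p dvd y\<^sup>2"
      using dvd_diff[OF dvd, of "x * (x + y)"] by (simp add: power2_eq_square algebra_simps)
    then show False using False pi prime_dvd_power by blast
  qed
  define k where "k = p div 3"
  \<comment> \<open>By Fermat \<open>x ^ (3 * k) * x\<close> and \<open>y ^ (3 * k) * y\<close> are
    both 1 modulo \<open>p\<close>, while equal cubes make the factors \<open>x ^ (3 * k)\<close>
    and \<open>y ^ (3 * k)\<close> agree; cancelling leaves \<open>x\<close> congruent to
    \<open>y\<close>.\<close>
  have pk: "p - 1 = 3 * k + 1" using p(2) by (simp add: k_def) presburger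
  have "x ^ 3 - y ^ 3 = (x - y) * (x\<^sup>2 + x * y + y\<^sup>2)"
    by (simp add: power2_eq_square power3_eq_cube algebra_simps)
  then have c3: "[x ^ 3 = y ^ 3] (mod int p)"
    using dvd by (simp add: cong_iff_dvd_diff)
  have ck: "[x ^ (3 * k) = y ^ (3 * k)] (mod int p)"
    using cong_pow[OF c3, of k] by (simp add: power_mult)
  have "[x ^ (3 * k) * x = y ^ (3 * k) * y] (mod int p)"
    using fermat_theorem_int[OF p(1) x] fermat_theorem_int[OF p(1) False]
    unfolding pk by (simp add: mult.commute) (metis cong_sym cong_trans)
  moreover have "[y ^ (3 * k) * y = x ^ (3 * k) * y] (mod int p)"
    using ck by (intro cong_mult) (auto simp: cong_sym)
  ultimately have "[x ^ (3 * k) * x = x ^ (3 * k) * y] (mod int p)"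
    using cong_trans by blast
  then have "int p dvd x ^ (3 * k) * (x - y)"
    by (simp add: cong_iff_dvd_diff right_diff_distrib)
  then have xy: "int p dvd x - y"
    using x pi prime_dvd_multD prime_dvd_power by blast
  \<comment> \<open>Once \<open>x\<close> and \<open>y\<close> are congruent the form reduces to
    \<open>3 * x\<^sup>2\<close>, which leaves only \<open>p = 3\<close>.\<close>
  have "3 * x\<^sup>2 = (x\<^sup>2 + x * y + y\<^sup>2) + (x - y) * (2 * x + y)"
    by (simp add: power2_eq_square algebra_simps)
  then have "int p dvd 3 * x\<^sup>2" using dvd xy by (metis dvd_add dvd_mult2)
  then have "int p dvd 3" using x pi prime_dvd_multD prime_dvd_power by blast
  then have "p dvd 3" by (metis int_dvd_int_iff of_nat_numeral)
  then have "p = 3" using p(1) primes_dvd_imp_eq[of p 3] by simp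
  then show ?thesis using p(2) by simp
qed

text \<open>Inertness removes one factor \<open>p\<close> from each variable for every factor
  \<open>p\<^sup>2\<close> of the value, until the value 3 remains.\<close>

lemma loeschian_inert_prime_power:
  fixes x y :: int and p t :: nat
  assumes p: "prime p" "p mod 3 = 2" and "x\<^sup>2 + x * y + y\<^sup>2 = 3 * int p ^ (2 * t)"
  shows "\<exists>x' y'. x = int p ^ t * x' \<and> y = int p ^ t * y' \<and> x'\<^sup>2 + x' * y' + y'\<^sup>2 = 3"
  using assms(3)
proof (induction t arbitrary: x y)
  case (Suc t)
  then have "int p dvd x\<^sup>2 + x * y + y\<^sup>2" by simp
  then obtain u v where uv: "x = int p * u" "y = int p * v"
    using prime_dvd_loeschian[OF p] by (metis dvdE)
  have "(int p)\<^sup>2 * (u\<^sup>2 + u * v + v\<^sup>2) = (int p)\<^sup>2 * (3 * int p ^ (2 * t))"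
    using Suc.prems by (simp add: uv power2_eq_square algebra_simps)
  then have "u\<^sup>2 + u * v + v\<^sup>2 = 3 * int p ^ (2 * t)"
    using p(1) by (subst (asm) mult_left_cancel) auto
  from Suc.IH[OF this] show ?case by (auto simp: uv)
qed auto

lemma loeschian_eq_3:
  fixes x y :: int
  assumes "x\<^sup>2 + x * y + y\<^sup>2 = 3"
  shows "(x, y) \<in> {(1,1), (1,-2), (-2,1), (-1,-1), (-1,2), (2,-1)}"
proof -
  have bd: "v \<in> {-2..2}" if "u\<^sup>2 + u * v + v\<^sup>2 = 3" for u v :: int
  proof -
    \<comment> \<open>Four times the form with the square completed bounds \<open>v\<close>, and by
      symmetry \<open>u\<close>.\<close>
    have "(2 * u + v)\<^sup>2 + 3 * v\<^sup>2 = 12"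
      using that by (simp add: power2_eq_square algebra_simps)
    then have "3 * v\<^sup>2 \<le> 12" using zero_le_power2[of "2 * u + v"] by linarith
    then have "\<bar>v\<bar>\<^sup>2 < 3\<^sup>2" by simp
    then have "\<bar>v\<bar> < 3" by (rule power2_less_imp_less) simp
    then show ?thesis by auto
  qed
  have "x\<^sup>2 + x * y + y\<^sup>2 = 3" "y\<^sup>2 + y * x + x\<^sup>2 = 3" using assms by (simp_all add: algebra_simps)
  from bd[OF this(1)] bd[OF this(2)] have "x \<in> {-2,-1,0,1,2}" "y \<in> {-2,-1,0,1,2}" by auto
  then show ?thesis using assms by (elim insertE emptyE; simp)
qed

text \<open>Eliminating \<open>z\<close> turns the square sum into twice the form
  \<open>x\<^sup>2 + x * y + y\<^sup>2\<close>, so the descent applies. The six remaining pairs come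
  from the orderings of (1, 1, -2) and its negative; since \<open>p\<close> is -1 modulo 3, the
  residue 1 of \<open>x\<close> selects the sign.\<close>

lemma inert_triple:
  fixes x y z :: int and p t :: nat
  assumes p: "prime p" "p mod 3 = 2"
    and sum: "x + y + z = 0" and sq: "x\<^sup>2 + y\<^sup>2 + z\<^sup>2 = 6 * int p ^ (2 * t)"
    and mod3: "x mod 3 = 1" "y mod 3 = 1" "z mod 3 = 1"
  shows "{#x, y, z#} = image_mset (\<lambda>u. (- 1) ^ t * int p ^ t * u) {#1, 1, -2#}"
proof -
  have z: "z = - x - y" using sum by simp
  have "x\<^sup>2 + x * y + y\<^sup>2 = 3 * int p ^ (2 * t)"
    using sq by (simp add: z power2_eq_square algebra_simps)
  then obtain x' y' where xy: "x = int p ^ t * x'" "y = int p ^ t * y'"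
      and e: "x'\<^sup>2 + x' * y' + y'\<^sup>2 = 3"
    using loeschian_inert_prime_power[OF p] by blast
  have "[int p = - 1] (mod 3)"
    using p(2) unfolding cong_def by presburger
  then have pt: "[int p ^ t = (- 1) ^ t] (mod 3)" by (rule cong_pow)
  have "[x = (- 1) ^ t * x'] (mod 3)"
    unfolding xy by (intro cong_mult pt) simp
  then have x': "((- 1) ^ t * x') mod 3 = 1" using mod3 by (simp add: cong_def)
  show ?thesis
  proof (cases "even t")
    case True
    then show ?thesis using loeschian_eq_3[OF e] x' by (auto simp: z xy)
  next
    case False
    then show ?thesis using loeschian_eq_3[OF e] x' by (auto simp: z xy)
  qed
qed


section \<open>Descent for integer triples with sum 0\<close>

text \<open>Modulo \<open>p\<close> the three numbers are the roots of X^3, so all of them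
  vanish.\<close>

lemma prime_dvd_triple:
  fixes x y z p :: int
  assumes "prime p" "x + y + z = 0" "p dvd x * y + y * z + z * x" "p dvd x * y * z"
  shows "p dvd x \<and> p dvd y \<and> p dvd z"
proof -
  have aux: "p dvd u \<and> p dvd v \<and> p dvd w"
    if "u + v + w = 0" "p dvd u * v + v * w + w * u" "p dvd u" for u v w :: int
  proof -
    have "p dvd (u * v + v * w + w * u) - u * (v + w)"
      using that by (intro dvd_diff dvd_mult2) auto
    then have "p dvd v * w" by (simp add: algebra_simps)
    then have vw: "p dvd v \<or> p dvd w" using assms(1) prime_dvd_mult_iff by blast
    have "v = - (u + w)" "w = - (u + v)" using that(1) by auto
    then show ?thesis using vw that(3) by (metis dvd_add dvd_minus_iff)
  qed
  have "p dvd x \<or> p dvd y \<or> p dvd z"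
    using assms(1,4) prime_dvd_mult_iff by blast
  moreover have "y + z + x = 0" "z + x + y = 0" using assms(2) by simp_all
  moreover have "y * z + z * x + x * y = x * y + y * z + z * x"
    "z * x + x * y + y * z = x * y + y * z + z * x" by simp_all
  ultimately show ?thesis
    using aux[of x y z] aux[of y z x] aux[of z x y] assms(2,3) by metis
qed

text \<open>Dividing the triple by \<open>p\<close> divides the second and third symmetric functions
  by p^2 and p^3, so \<open>prime_dvd_triple\<close> can be repeated \<open>j\<close> times. The
  application has \<open>s = j = t\<close> and field size p^(3t).\<close>

lemma split_triple_descent:
  fixes x y z c p :: int and s j :: nat
  assumes "prime p" "s > 0" "x + y + z = 0"
    "x * y + y * z + z * x = - 3 * p ^ (s + 2 * j)" "x * y * z = p ^ (3 * j) * c"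
  shows "\<exists>x' y' z'. x = p ^ j * x' \<and> y = p ^ j * y' \<and> z = p ^ j * z' \<and> x' + y' + z' = 0 \<and>
    x' * y' + y' * z' + z' * x' = - 3 * p ^ s \<and> x' * y' * z' = c"
  using assms(3-5)
proof (induction j arbitrary: x y z)
  case (Suc j)
  have p0: "p \<noteq> 0" using assms(1) by auto
  have "p dvd x * y + y * z + z * x" "p dvd x * y * z" using Suc.prems(2,3) by simp_all
  then obtain u v w where uvw: "x = p * u" "y = p * v" "z = p * w"
    using prime_dvd_triple[OF assms(1) Suc.prems(1)] by (metis dvdE)
  have "p * (u + v + w) = 0" using Suc.prems(1) by (simp add: uvw algebra_simps)
  then have 1: "u + v + w = 0" using p0 by simp
  have "p\<^sup>2 * (u * v + v * w + w * u) = p\<^sup>2 * (- 3 * p ^ (s + 2 * j))"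
    using Suc.prems(2) by (simp add: uvw power2_eq_square algebra_simps)
  then have 2: "u * v + v * w + w * u = - 3 * p ^ (s + 2 * j)"
    using p0 by (subst (asm) mult_left_cancel) auto
  have "p ^ 3 * (u * v * w) = p ^ 3 * (p ^ (3 * j) * c)"
    using Suc.prems(3) by (simp add: uvw power3_eq_cube power_add algebra_simps)
  then have 3: "u * v * w = p ^ (3 * j) * c"
    using p0 by (subst (asm) mult_left_cancel) auto
  from Suc.IH[OF 1 2 3] show ?case by (auto simp: uvw)
qed auto

text \<open>Of three integers that are 1 modulo 3 and sum to 0, exactly two agree modulo 9; the third
  one is \<open>a\<close>, and the difference of those two is \<open>9b\<close>.\<close>

lemma split_triple:
  fixes x y z P :: int
  assumes sum: "x + y + z = 0" and e2: "x * y + y * z + z * x = - 3 * P"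
    and mod3: "x mod 3 = 1" "y mod 3 = 1" "z mod 3 = 1"
  shows "\<exists>a b u v. {#x, y, z#} = {#a, u, v#} \<and> 2 * u = - (a + 9 * b) \<and> 2 * v = - (a - 9 * b) \<and>
    4 * P = a\<^sup>2 + 27 * b\<^sup>2"
proof -
  have aux: "\<exists>b. 2 * v = - (u + 9 * b) \<and> 2 * w = - (u - 9 * b) \<and> 4 * P = u\<^sup>2 + 27 * b\<^sup>2"
    if s: "u + v + w = 0" and e: "u * v + v * w + w * u = - 3 * P" and d: "9 dvd w - v" for u v w :: int
  proof -
    obtain b where "w - v = 9 * b" using d by (elim dvdE)
    then have w: "w = v + 9 * b" by simp
    have u: "u = - 2 * v - 9 * b" using s w by simp
    have "3 * (4 * P) = 3 * (u\<^sup>2 + 27 * b\<^sup>2)"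
      using e unfolding u w power2_eq_square by (simp add: algebra_simps)
    then show ?thesis using u w by (intro exI[of _ b]) auto
  qed
  have "9 dvd z - y \<or> 9 dvd x - z \<or> 9 dvd y - x"
  proof -
    have "x = 3 * (x div 3) + 1" "y = 3 * (y div 3) + 1" using mod3 by presburger+
    then obtain i j where ij: "x = 3 * i + 1" "y = 3 * j + 1" by blast
    then have z: "z = - 3 * i - 3 * j - 2" using sum by simp
    \<comment> \<open>Modulo 3 the three forms depend only on \<open>d = j - i\<close>, as
      \<open>1 - d\<close>, \<open>1 + d\<close> and \<open>d\<close>, so one of them
      vanishes.\<close>
    have "3 dvd 2 * j + i + 1 \<or> 3 dvd 2 * i + j + 1 \<or> 3 dvd j - i" by presburger
    moreover have "z - y = - (3 * (2 * j + i + 1))" "x - z = 3 * (2 * i + j + 1)" "y - x = 3 * (j - i)"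
      unfolding ij z by simp_all
    moreover have "9 dvd 3 * k" if "3 dvd k" for k :: int using that by presburger
    ultimately show ?thesis by (metis dvd_minus_iff)
  qed
  then consider "9 dvd z - y" | "9 dvd x - z" | "9 dvd y - x" by blast
  then show ?thesis
  proof cases
    case 1 with aux[of x y z] sum e2 obtain b where
      "2 * y = - (x + 9 * b) \<and> 2 * z = - (x - 9 * b) \<and> 4 * P = x\<^sup>2 + 27 * b\<^sup>2"
      by auto
    then show ?thesis by (intro exI[of _ x] exI[of _ b] exI[of _ y] exI[of _ z]) auto
  next
    case 2 with aux[of y z x] sum e2 obtain b where
      "2 * z = - (y + 9 * b) \<and> 2 * x = - (y - 9 * b) \<and> 4 * P = y\<^sup>2 + 27 * b\<^sup>2"
      by (auto simp: algebra_simps)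
    then show ?thesis by (intro exI[of _ y] exI[of _ b] exI[of _ z] exI[of _ x]) auto
  next
    case 3 with aux[of z x y] sum e2 obtain b where
      "2 * x = - (z + 9 * b) \<and> 2 * y = - (z - 9 * b) \<and> 4 * P = z\<^sup>2 + 27 * b\<^sup>2"
      by (auto simp: algebra_simps)
    then show ?thesis by (intro exI[of _ z] exI[of _ b] exI[of _ x] exI[of _ y]) auto
  qed
qed

section \<open>Uniqueness of the representation 4P = a^2 + 27b^2\<close>

text \<open>Composing the two representations writes \<open>16 * P\<^sup>2\<close> as a square plus
  27 times the square of the determinant \<open>a * b' - a' * b\<close>. A nonzero multiple of
  \<open>2 * P\<close> would be too large, so the determinant vanishes; the pairs are then
  proportional and the residue modulo 3 fixes the sign of \<open>a\<close>.\<close>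

lemma represent_unique_aux:
  fixes a b a' b' P :: int
  assumes P: "P > 0" "odd P" and eq: "4 * P = a\<^sup>2 + 27 * b\<^sup>2" "4 * P = a'\<^sup>2 + 27 * b'\<^sup>2"
    and mod3: "a mod 3 = 1" "a' mod 3 = 1" and dvd: "P dvd a * b' - a' * b"
  shows "a = a' \<and> \<bar>b\<bar> = \<bar>b'\<bar>"
proof -
  have "even (a\<^sup>2 + 27 * b\<^sup>2)" "even (a'\<^sup>2 + 27 * b'\<^sup>2)" unfolding eq[symmetric] by simp_all
  then have "even a \<longleftrightarrow> even b" "even a' \<longleftrightarrow> even b'" by auto
  then have "2 dvd a * b' - a' * b" by auto
  moreover have "coprime 2 P" using P(2) by simp
  ultimately have "2 * P dvd a * b' - a' * b" using dvd divides_mult by blast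
  then obtain k where k: "a * b' - a' * b = 2 * P * k" by (elim dvdE)
  have "16 * P\<^sup>2 = (4 * P) * (4 * P)" by (simp add: power2_eq_square)
  also have "\<dots> = (a\<^sup>2 + 27 * b\<^sup>2) * (a'\<^sup>2 + 27 * b'\<^sup>2)" using eq by simp
  also have "\<dots> = (a * a' + 27 * b * b')\<^sup>2 + 27 * (a * b' - a' * b)\<^sup>2"
    by (simp add: power2_eq_square algebra_simps)
  also have "\<dots> = (a * a' + 27 * b * b')\<^sup>2 + P\<^sup>2 * (108 * k\<^sup>2)"
    unfolding k by (simp add: power2_eq_square algebra_simps)
  finally have "P\<^sup>2 * (108 * k\<^sup>2) \<le> P\<^sup>2 * 16"
    using zero_le_power2[of "a * a' + 27 * b * b'"] by linarith
  then have "108 * k\<^sup>2 \<le> 16" using P(1) by (simp add: mult_le_cancel_left)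
  then have "k\<^sup>2 < 1" by linarith
  then have "k = 0" by (simp add: abs_square_less_1)
  then have ab: "a * b' = a' * b" using k by simp
  have "a\<^sup>2 * (4 * P) = a\<^sup>2 * a'\<^sup>2 + 27 * (a * b')\<^sup>2"
    unfolding eq(2) by (simp add: power2_eq_square algebra_simps)
  also have "\<dots> = a'\<^sup>2 * (4 * P)"
    unfolding ab eq(1) by (simp add: power2_eq_square algebra_simps)
  finally have "a\<^sup>2 = a'\<^sup>2" using P(1) by simp
  then have "a = a' \<or> a = - a'" by (simp add: power2_eq_iff)
  then have a: "a = a'" using mod3 by presburger
  then have "b\<^sup>2 = b'\<^sup>2" using eq by simp
  then have "\<bar>b\<bar> = \<bar>b'\<bar>" by (auto simp: power2_eq_iff)
  with a show ?thesis by simp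
qed

text \<open>The prime power divides \<open>(a * b' - a' * b) * (a * b' + a' * b)\<close>, and
  \<open>p\<close> cannot divide both factors, as it would divide \<open>2 * (a * b')\<close>. Hence
  the whole power divides one factor, and a change of sign of \<open>b\<close> exchanges the
  two.\<close>

lemma represent_unique:
  fixes a b a' b' :: int and p t :: nat
  assumes p: "prime p" "p mod 3 = 1" and t: "t > 0"
    and eq: "4 * int p ^ t = a\<^sup>2 + 27 * b\<^sup>2" "4 * int p ^ t = a'\<^sup>2 + 27 * b'\<^sup>2"
    and mod3: "a mod 3 = 1" "a' mod 3 = 1" and cop: "\<not> int p dvd a" "\<not> int p dvd a'"
  shows "a = a' \<and> \<bar>b\<bar> = \<bar>b'\<bar>"
proof -
  let ?P = "int p ^ t"
  have pi: "prime (int p)" using p(1) by simp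
  have "p \<noteq> 2" using p(2) by auto
  then have oddp: "odd p" using p(1) by (metis prime_nat_iff two_is_prime_nat primes_dvd_imp_eq)
  then have P: "?P > 0" "odd ?P" by (auto simp: odd_pos)
  have b': "\<not> int p dvd b'"
  proof
    assume "int p dvd b'"
    then have "int p dvd 4 * ?P - 27 * b'\<^sup>2" using t
      by (intro dvd_diff) (auto simp: power2_eq_square)
    then have "int p dvd a'\<^sup>2" using eq(2) by simp
    then show False using cop(2) pi prime_dvd_power by blast
  qed
  have prod: "(a * b' - a' * b) * (a * b' + a' * b) = 4 * ?P * (b'\<^sup>2 - b\<^sup>2)"
  proof -
    have "(a * b' - a' * b) * (a * b' + a' * b) = a\<^sup>2 * b'\<^sup>2 - a'\<^sup>2 * b\<^sup>2"
      by (simp add: power2_eq_square algebra_simps)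
    also have "a\<^sup>2 = 4 * ?P - 27 * b\<^sup>2" using eq(1) by simp
    also have "a'\<^sup>2 = 4 * ?P - 27 * b'\<^sup>2" using eq(2) by simp
    finally show ?thesis by (simp add: algebra_simps)
  qed
  then have dvd: "?P dvd (a * b' - a' * b) * (a * b' + a' * b)" by simp
  have "\<not> (int p dvd a * b' - a' * b \<and> int p dvd a * b' + a' * b)"
  proof
    assume "int p dvd a * b' - a' * b \<and> int p dvd a * b' + a' * b"
    then have "int p dvd (a * b' - a' * b) + (a * b' + a' * b)" using dvd_add by blast
    then have "int p dvd 2 * (a * b')" by simp
    then have "int p dvd 2" using pi cop(1) b' prime_dvd_mult_iff by blast
    then have "p dvd 2" by (metis int_dvd_int_iff of_nat_numeral)
    then show False using \<open>p \<noteq> 2\<close> p(1) primes_dvd_imp_eq two_is_prime_nat by blast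
  qed
  then consider "coprime ?P (a * b' + a' * b)" | "coprime ?P (a * b' - a' * b)"
    using pi prime_imp_coprime[of "int p"] by auto
  then show ?thesis
  proof cases
    case 1
    then have "?P dvd a * b' - a' * b" using dvd coprime_dvd_mult_left_iff by blast
    then show ?thesis using represent_unique_aux[OF P eq mod3] by blast
  next
    case 2
    then have "?P dvd a * b' + a' * b" using dvd coprime_dvd_mult_right_iff by blast
    then have "?P dvd a * b' - a' * (- b)" by simp
    then show ?thesis using represent_unique_aux[OF P, of a "- b" a' b'] eq mod3 by simp
  qed
qed

section \<open>Central binomial coefficients modulo p\<close>

text \<open>The multiples of \<open>p\<close> among the factors contribute
  \<open>p ^ a * fact a\<close>; \<open>u\<close> collects the other factors. In the inner base case
  the next multiple of \<open>p\<close> follows the complete block ending at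
  \<open>p * a + (p - 1)\<close>.\<close>

lemma fact_mult_add_prime:
  fixes p a b :: nat
  assumes p: "prime p" and b: "b < p"
  shows "\<exists>u. fact (p * a + b) = p ^ a * fact a * u \<and> \<not> p dvd u"
  using b
proof (induction a arbitrary: b)
  case 0
  then show ?case using prime_dvd_fact_iff[OF p] by (intro exI[of _ "fact b"]) auto
next
  case (Suc a)
  have p0: "p > 0" using p prime_gt_0_nat by blast
  from Suc.prems show ?case
  proof (induction b)
    case 0
    obtain u where u: "fact (p * a + (p - 1)) = p ^ a * fact a * u" "\<not> p dvd u"
      using Suc.IH[of "p - 1"] p0 by auto
    have "p * Suc a + 0 = Suc (p * a + (p - 1))" using p0 by simp
    then have "fact (p * Suc a + 0) = (p * Suc a) * fact (p * a + (p - 1))"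
      by (metis fact_Suc of_nat_id add_0_right)
    also have "\<dots> = p ^ Suc a * fact (Suc a) * u"
      unfolding u(1) by (simp add: algebra_simps)
    finally show ?case using u(2) by blast
  next
    case (Suc b)
    then obtain u where u: "fact (p * Suc a + b) = p ^ Suc a * fact (Suc a) * u" "\<not> p dvd u"
      by (metis Suc_lessD)
    have "fact (p * Suc a + Suc b) = (p * Suc a + Suc b) * fact (p * Suc a + b)"
      by (metis add_Suc_right fact_Suc of_nat_id)
    also have "\<dots> = p ^ Suc a * fact (Suc a) * (u * (p * Suc a + Suc b))"
      unfolding u(1) by (simp only: mult_ac)
    finally have "fact (p * Suc a + Suc b) = p ^ Suc a * fact (Suc a) * (u * (p * Suc a + Suc b))" .
    moreover have "\<not> p dvd p * Suc a + Suc b"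
      using Suc.prems by (metis dvd_add_right_iff dvd_triv_left nat_dvd_not_less zero_less_Suc)
    ultimately show ?case using u(2) p prime_dvd_mult_iff by blast
  qed
qed

text \<open>A case of Lucas's theorem: the last base-p digit \<open>b\<close> doubles without a
  carry, so it contributes only a factor prime to \<open>p\<close>.\<close>

lemma prime_dvd_central_binomial_step:
  fixes p a b :: nat
  assumes p: "prime p" and b: "2 * b < p"
  shows "p dvd (2 * (p * a + b) choose (p * a + b)) \<longleftrightarrow> p dvd (2 * a choose a)"
proof -
  let ?n = "p * a + b"
  obtain u where u: "fact (p * (2 * a) + 2 * b) = p ^ (2 * a) * fact (2 * a) * u" "\<not> p dvd u"
    using fact_mult_add_prime[OF p b] by blast
  obtain v where v: "fact ?n = p ^ a * fact a * v" "\<not> p dvd v"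
    using fact_mult_add_prime[OF p, of b a] b by auto
  have n2: "p * (2 * a) + 2 * b = 2 * ?n" by simp
  have F: "fact k * fact k * (2 * k choose k) = (fact (2 * k) :: nat)" for k
    using binomial_fact_lemma[of k "2 * k"] by simp
  have "(p ^ a * fact a)\<^sup>2 * (v\<^sup>2 * (2 * ?n choose ?n)) = fact ?n * fact ?n * (2 * ?n choose ?n)"
    unfolding v(1) by (simp add: power2_eq_square mult_ac)
  also have "\<dots> = p ^ (2 * a) * fact (2 * a) * u" using F u(1) n2 by metis
  also have "\<dots> = p ^ (2 * a) * (fact a * fact a * (2 * a choose a)) * u" by (simp only: F)
  also have "\<dots> = (p ^ a * fact a)\<^sup>2 * (u * (2 * a choose a))"
    by (simp add: power2_eq_square mult_ac power_mult)
  finally have "v\<^sup>2 * (2 * ?n choose ?n) = u * (2 * a choose a)"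
    using p by (subst (asm) mult_left_cancel) auto
  moreover have "\<not> p dvd v\<^sup>2" using v(2) p prime_dvd_power by blast
  ultimately show ?thesis using u(2) p prime_dvd_mult_iff by metis
qed

text \<open>All base-p digits of \<open>(p ^ m - 1) div 3\<close> equal
  \<open>k = (p - 1) div 3\<close>, and \<open>2 * k < p\<close>, so the digits can be stripped one
  by one.\<close>

lemma not_prime_dvd_central_binomial:
  fixes p m :: nat
  assumes p: "prime p" "p mod 3 = 1"
  shows "\<not> p dvd (2 * ((p ^ m - 1) div 3) choose ((p ^ m - 1) div 3))"
proof (induction m)
  case 0
  then show ?case using p(1) by auto
next
  case (Suc m)
  define k where "k = p div 3"
  have pk: "p = 3 * k + 1" using p(2) by (simp add: k_def) presburger
  have "p ^ m mod 3 = 1" using p(2) power_mod[of p 3 m] by simp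
  then obtain N where N: "p ^ m = 3 * N + 1" by (metis mult_div_mod_eq)
  have "p ^ Suc m = 3 * (p * N) + p" by (simp add: N algebra_simps)
  moreover have "A - 1 = 3 * (B + k)" if "A = 3 * B + p" for A B using that pk by simp
  ultimately have "p ^ Suc m - 1 = 3 * (p * N + k)" by blast
  then have n: "(p ^ Suc m - 1) div 3 = p * N + k" by (metis nonzero_mult_div_cancel_left zero_neq_numeral)
  have "(p ^ m - 1) div 3 = N" using N by simp
  moreover have "2 * k < p" using pk by linarith
  ultimately show ?case
    unfolding n using Suc prime_dvd_central_binomial_step[OF p(1)] by metis
qed

section \<open>Finite fields and spectra\<close>

lemma CHAR_eq_if_CARD_prime_power:
  assumes "prime p" "CARD('a::{field,finite}) = p ^ m"
  shows "CHAR('a) = p"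
proof -
  have "prime CHAR('a)"
    using prime_CHAR_semidom[where ?'a = 'a] finite_imp_CHAR_pos[where ?'a = 'a] by simp
  moreover have "CHAR('a) dvd p ^ m"
    using CHAR_dvd_CARD[where ?'a = 'a] assms(2) by simp
  ultimately show ?thesis
    using assms(1) prime_dvd_power primes_dvd_imp_eq by blast
qed

lemma power_CARD_minus_1:
  fixes x :: "'a::{field,finite}"
  assumes "x \<noteq> 0"
  shows "x ^ (CARD('a) - 1) = 1"
proof -
  let ?U = "UNIV - {0::'a}"
  have "\<Prod>?U = (\<Prod>y\<in>?U. x * y)"
    by (rule prod.reindex_bij_witness[of _ "\<lambda>y. x * y" "\<lambda>y. y / x"]) (use assms in auto)
  also have "\<dots> = x ^ (CARD('a) - 1) * \<Prod>?U"
    by (simp add: prod.distrib)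
  finally show ?thesis by simp
qed

lemma power_CARD:
  fixes x :: "'a::{field,finite}"
  shows "x ^ CARD('a) = x"
proof (cases "x = 0")
  case False
  have "x ^ CARD('a) = x * x ^ (CARD('a) - 1)"
    using finite_UNIV_card_ge_0[where ?'a = 'a] by (simp flip: power_Suc)
  then show ?thesis using power_CARD_minus_1[OF False] by simp
qed (simp add: zero_power)

lemma card_roots_of_unity_le:
  assumes "k > 0"
  shows "card {x::'a::idom. x ^ k = 1} \<le> k"
proof -
  let ?P = "Polynomial.monom (1::'a) k - 1"
  have "Polynomial.coeff ?P k = 1" using assms by simp
  then have "?P \<noteq> 0" by (metis coeff_0 zero_neq_one)
  then have "card {x. poly ?P x = 0} \<le> Polynomial.degree ?P" by (rule card_poly_roots_bound)
  also have "Polynomial.degree ?P \<le> k"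
    by (intro degree_diff_le) (auto simp: degree_monom_le)
  finally show ?thesis by (simp add: poly_monom)
qed

text \<open>This takes the place of a generator of the multiplicative group: X^k - 1 has too few
  roots to vanish at every nonzero element.\<close>

lemma ex_nonzero_power_neq_1:
  assumes "0 < k" "k < CARD('a::{field,finite}) - 1"
  shows "\<exists>y::'a. y \<noteq> 0 \<and> y ^ k \<noteq> 1"
proof (rule ccontr)
  assume "\<not> ?thesis"
  then have "UNIV - {0} \<subseteq> {y::'a. y ^ k = 1}" by auto
  then have "card (UNIV - {0::'a}) \<le> card {y::'a. y ^ k = 1}" by (intro card_mono) auto
  also have "\<dots> \<le> k" by (rule card_roots_of_unity_le) fact
  finally show False using assms(2) by simp
qed

text \<open>If \<open>y ^ k\<close> differs from 1, the substitution of \<open>y * x\<close> for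
  \<open>x\<close> multiplies the sum by \<open>y ^ k\<close>, so the sum is 0. Otherwise every
  nonzero element contributes 1, and the field size is 0 in the field.\<close>

lemma sum_powers_finite_field:
  fixes k :: nat
  assumes "k > 0"
  shows "(\<Sum>x\<in>UNIV. x ^ k) = (if CARD('a) - 1 dvd k then - 1 else (0::'a::{field,finite}))"
proof (cases "CARD('a) - 1 dvd k")
  case True
  then have "x ^ k = (if x = 0 then 0 else 1)" for x :: 'a
    using power_CARD_minus_1[of x] assms by (auto elim!: dvdE simp: power_mult zero_power)
  then have "(\<Sum>x\<in>UNIV. x ^ k) = (\<Sum>x\<in>UNIV - {0::'a}. 1::'a)"
    by (intro sum.mono_neutral_cong_right) auto
  also have "\<dots> = of_nat (CARD('a) - 1)" by simp
  also have "\<dots> = of_nat CARD('a) - 1"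
    using finite_UNIV_card_ge_0[where ?'a = 'a] by (simp add: of_nat_diff Suc_leI)
  also have "of_nat CARD('a) = (0::'a)"
    using CHAR_dvd_CARD[where ?'a = 'a] of_nat_eq_0_iff_char_dvd by blast
  finally show ?thesis using True by simp
next
  case False
  \<comment> \<open>Reducing the exponent brings it into the range of
    \<open>ex_nonzero_power_neq_1\<close>.\<close>
  define r where "r = k mod (CARD('a) - 1)"
  have pow: "x ^ k = x ^ r" if "x \<noteq> 0" for x :: 'a
  proof -
    have "x ^ k = x ^ ((CARD('a) - 1) * (k div (CARD('a) - 1)) + r)" by (simp add: r_def)
    also have "\<dots> = x ^ r" using power_CARD_minus_1[OF that] by (simp add: power_add power_mult)
    finally show ?thesis .
  qed
  have "card {0, 1::'a} \<le> CARD('a)" by (intro card_mono) auto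
  then have "CARD('a) > 1" by simp
  then have "0 < r" "r < CARD('a) - 1" using False by (auto simp: r_def dvd_eq_mod_eq_0)
  then obtain y :: 'a where y: "y \<noteq> 0" "y ^ r \<noteq> 1" using ex_nonzero_power_neq_1 by blast
  have "(\<Sum>x\<in>UNIV. x ^ k) = (\<Sum>x\<in>UNIV. (y * x) ^ k)"
    by (rule sum.reindex_bij_witness[of _ "\<lambda>x. y * x" "\<lambda>x. x / y"]) (use y in auto)
  also have "\<dots> = y ^ r * (\<Sum>x\<in>UNIV. x ^ k)"
    using pow[OF y(1)] by (simp add: power_mult_distrib sum_distrib_left)
  finally have "(1 - y ^ r) * (\<Sum>x\<in>UNIV. x ^ k) = 0" by (simp add: algebra_simps)
  then show ?thesis using y(2) False by simp
qed

text \<open>X^p - X has at most \<open>p\<close> roots, and the images of the integers below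
  \<open>p\<close> already supply that many.\<close>

lemma prime_field_eq:
  assumes p: "prime p" "CHAR('a::field) = p"
  shows "{y::'a. y ^ p = y} = of_nat ` {..<p}"
proof (rule sym, rule card_seteq)
  let ?P = "Polynomial.monom (1::'a) p - Polynomial.monom 1 1"
  have p1: "p > 1" using p(1) prime_gt_1_nat by blast
  have pc: "prime CHAR('a)" using p by simp
  have "Polynomial.coeff ?P p = 1" using p1 by simp
  then have P: "?P \<noteq> 0" by (metis coeff_0 zero_neq_one)
  have eq: "{y::'a. y ^ p = y} = {y. poly ?P y = 0}" by (simp add: poly_monom)
  show "finite {y::'a. y ^ p = y}" unfolding eq using P by (rule poly_roots_finite)
  have "card {y. poly ?P y = 0} \<le> Polynomial.degree ?P" using P by (rule card_poly_roots_bound)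
  also have "Polynomial.degree ?P \<le> p"
    using p1 by (intro degree_diff_le) (auto intro: order.trans[OF degree_monom_le])
  finally have "card {y::'a. y ^ p = y} \<le> p" unfolding eq .
  moreover have "inj_on (of_nat :: nat \<Rightarrow> 'a) {..<p} \<Longrightarrow> card (of_nat ` {..<p} :: 'a set) = p"
    by (simp add: card_image)
  moreover have "inj_on (of_nat :: nat \<Rightarrow> 'a) {..<p}"
    by (rule inj_onI) (use p(2) in \<open>auto simp: of_nat_eq_iff_cong_CHAR cong_def\<close>)
  ultimately show "card {y::'a. y ^ p = y} \<le> card (of_nat ` {..<p} :: 'a set)" by simp
  \<comment> \<open>The Frobenius map is additive, applied to a sum of \<open>k\<close>
    ones.\<close>
  have "of_nat k ^ p = (of_nat k :: 'a)" for k
    using freshmans_dream_sum[OF pc p(2)[symmetric], of "\<lambda>_. 1" "{..<k}"] by simp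
  then show "of_nat ` {..<p} \<subseteq> {y::'a. y ^ p = y}" by auto
qed

text \<open>The witness is the absolute trace, read as an integer in \<open>{0..<p}\<close>.\<close>

lemma ex_additive_functional:
  assumes p: "prime p" and card: "CARD('a::{field,finite}) = p ^ m"
  shows "\<exists>T::'a \<Rightarrow> nat. (\<forall>x. T x < p) \<and> (\<forall>x y. T (x + y) = (T x + T y) mod p) \<and> (\<exists>x. T x \<noteq> 0)"
proof -
  have char: "CHAR('a) = p" using CHAR_eq_if_CARD_prime_power[OF p card] .
  have pc: "prime CHAR('a)" using p char by simp
  have p1: "p > 1" using p prime_gt_1_nat by blast
  have "CARD('a) \<noteq> 1"
    by (metis UNIV_I card_1_singletonE singletonD zero_neq_one)
  then have "m \<noteq> 0" using card by (metis power_0)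
  then obtain k where k: "m = Suc k" using not0_implies_Suc by blast
  define tr :: "'a \<Rightarrow> 'a" where "tr x = (\<Sum>i<m. x ^ (p ^ i))" for x
  have tr_add: "tr (x + y) = tr x + tr y" for x y
    using freshmans_dream'[OF pc refl, of x y] by (simp add: tr_def sum.distrib char)
  \<comment> \<open>Frobenius permutes the summands cyclically because
    \<open>x ^ (p ^ m) = x\<close>, so the trace lies in the prime field.\<close>
  have "tr x ^ p = tr x" for x
  proof -
    have "tr x ^ p = (\<Sum>i<m. x ^ (p ^ Suc i))"
      using freshmans_dream_sum[OF pc char[symmetric], of "\<lambda>i. x ^ (p ^ i)" "{..<m}"]
      by (simp add: tr_def mult.commute flip: power_mult)
    moreover have "(\<Sum>i<Suc m. x ^ (p ^ i)) = x + (\<Sum>i<m. x ^ (p ^ Suc i))"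
      by (subst sum.lessThan_Suc_shift) simp
    moreover have "(\<Sum>i<Suc m. x ^ (p ^ i)) = tr x + x"
      using power_CARD[of x] card by (simp add: tr_def)
    ultimately show ?thesis by simp
  qed
  then have "tr x \<in> of_nat ` {..<p}" for x
    using prime_field_eq[OF p char] by blast
  then have "\<forall>x. \<exists>k<p. tr x = of_nat k" by auto
  then obtain T where T: "\<And>x. T x < p" "\<And>x. tr x = of_nat (T x)" by metis
  have "T (x + y) = (T x + T y) mod p" for x y
  proof -
    have "of_nat (T (x + y)) = (of_nat (T x + T y) :: 'a)"
      using tr_add[of x y] by (simp add: T(2))
    then have "T (x + y) mod p = (T x + T y) mod p"
      unfolding of_nat_eq_iff_cong_CHAR char cong_def .
    then show ?thesis using T(1) by simp
  qed
  moreover have "\<exists>x. T x \<noteq> 0"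
  proof (rule ccontr)
    assume "\<not> ?thesis"
    then have tr0: "tr x = 0" for x by (simp add: T(2))
    \<comment> \<open>A vanishing trace would give this polynomial p^m roots. It is nonzero, since
      its linear coefficient is 1, and its degree is at most p^(m-1).\<close>
    define P where "P = (\<Sum>i<m. Polynomial.monom (1::'a) (p ^ i))"
    have "Polynomial.coeff P 1 = (\<Sum>i<m. if i = 0 then 1 else 0)"
      unfolding P_def coeff_sum using p1 by (intro sum.cong) auto
    also have "\<dots> = 1" using k by simp
    finally have "P \<noteq> 0" by auto
    then have "card {x. poly P x = 0} \<le> Polynomial.degree P" by (rule card_poly_roots_bound)
    moreover have "poly P x = 0" for x
      using tr0[of x] by (simp add: P_def poly_sum poly_monom tr_def)
    moreover have "Polynomial.degree P \<le> p ^ k"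
      unfolding P_def using p1
      by (intro degree_sum_le) (auto intro!: order.trans[OF degree_monom_le] power_increasing simp: k)
    ultimately have "p ^ m \<le> p ^ k" using card by simp
    then show False using p1 by (simp add: k)
  qed
  ultimately show ?thesis using T(1) by blast
qed

section \<open>Spectrum from an orthogonal eigenbasis\<close>

text \<open>With the eigenvectors as columns of a constant matrix \<open>P\<close>, the
  characteristic matrix satisfies \<open>B ** P = P ** D\<close>. Orthogonality makes the square of
  \<open>det P\<close> a power of \<open>c\<close>, so \<open>det P\<close> cancels and
  multiplicities come out directly.\<close>

lemma is_spectrum_if_orthogonal_eigenbasis:
  fixes A :: "real ^'n ^'n" and H :: "'n \<Rightarrow> 'n \<Rightarrow> real"
  assumes eig: "\<And>u b. (\<Sum>v\<in>UNIV. A $ u $ v * H v b) = l b * H u b"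
    and orth: "\<And>u v. (\<Sum>b\<in>UNIV. H u b * H v b) = (if u = v then c else 0)" and c: "c \<noteq> 0"
  shows "is_spectrum A (image_mset l (mset_set UNIV))"
proof -
  define B :: "real poly ^'n ^'n" where "B = (\<chi> i j. (if i = j then [:0, 1:] else 0) - [:A $ i $ j:])"
  define P :: "real poly ^'n ^'n" where "P = (\<chi> u b. [:H u b:])"
  define D :: "real poly ^'n ^'n" where "D = (\<chi> u b. if u = b then [:- l b, 1:] else 0)"
  have const_sum: "(\<Sum>x\<in>S. [:f x:]) = [:sum f S:]" for f :: "'n \<Rightarrow> real" and S
    by (induction S rule: infinite_finite_induct) auto
  have "B ** P = P ** D"
  proof (simp add: vec_eq_iff, intro allI)
    fix u b
    have "(B ** P) $ u $ b = (\<Sum>v\<in>UNIV. (if u = v then [:0, 1:] else 0) * [:H v b:]) - (\<Sum>v\<in>UNIV. [:A $ u $ v * H v b:])"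
      by (simp add: matrix_matrix_mult_def B_def P_def left_diff_distrib smult_diff_right mult.commute flip: sum_subtractf)
    also have "(\<Sum>v\<in>UNIV. (if u = v then [:0, 1:] else 0) * [:H v b:]) = [:0, H u b:]"
      by (simp add: if_distrib[of "Polynomial.smult _"] cong: if_cong)
    also have "(\<Sum>v\<in>UNIV. [:A $ u $ v * H v b:]) = [:l b * H u b:]"
      by (simp add: const_sum eig)
    finally have "(B ** P) $ u $ b = [:- l b * H u b, H u b:]" by simp
    moreover have "(P ** D) $ u $ b = (\<Sum>v\<in>UNIV. if v = b then [:H u v:] * [:- l b, 1:] else 0)"
      unfolding matrix_matrix_mult_def P_def D_def by (simp add: if_distrib cong: if_cong)
    ultimately show "(B ** P) $ u $ b = (P ** D) $ u $ b" by (simp add: mult.commute)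
  qed
  then have det_eq: "det B * det P = det P * det D" by (metis det_mul)
  have "P ** transpose P = (\<chi> u v. if u = v then [:c:] else 0)"
    by (simp add: vec_eq_iff matrix_matrix_mult_def P_def transpose_def const_sum orth mult.commute)
  then have "det P * det P = (\<Prod>i\<in>(UNIV::'n set). [:c:])"
    using det_mul[of P "transpose P"] det_diagonal[of "(\<chi> u v. if u = v then [:c:] else 0) :: real poly ^'n ^'n"] by simp
  then have "det P \<noteq> 0" using c by auto
  then have "det B = det D" using det_eq by simp
  also have "\<dots> = (\<Prod>b\<in>UNIV. [:- l b, 1:])"
    using det_diagonal[of D] by (simp add: D_def)
  finally show ?thesis
    by (simp add: is_spectrum_def charpoly_def B_def prod_unfold_prod_mset image_mset.compositionality comp_def)
qed

section \<open>Cubic periods\<close>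

text \<open>\<open>T\<close> is a nonzero additive map to the integers modulo \<open>p\<close>,
  stored by representatives. The divisibility hypothesis of the theorem enters as
  \<open>p - 1 dvd n\<close>.\<close>

locale cubic_field =
  fixes p m n :: nat and T :: "'a::{field,finite} \<Rightarrow> nat"
  assumes prime_p: "prime p" and card_prime_power: "CARD('a) = p ^ m"
    and card_field: "CARD('a) = 3 * n + 1" and n_gt_1: "n > 1" and prime_field_dvd: "p - 1 dvd n"
    and T_less: "T x < p" and T_add: "T (x + y) = (T x + T y) mod p" and T_nontrivial: "\<exists>x. T x \<noteq> 0"
begin

abbreviation "card_F \<equiv> 3 * n + 1"
abbreviation "R \<equiv> (cubes :: 'a set)"

lemma char_p: "CHAR('a) = p"
  using CHAR_eq_if_CARD_prime_power[OF prime_p card_prime_power] .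

lemma p_gt_1: "p > 1"
  using prime_p prime_gt_1_nat by blast

lemma of_nat_eq_0_iff_p: "of_nat k = (0::'a) \<longleftrightarrow> p dvd k"
  using of_nat_eq_0_iff_char_dvd[where ?'a = 'a] char_p by simp

lemma of_nat_q: "of_nat card_F = (0::'a)"
  using CHAR_dvd_CARD[where ?'a = 'a] of_nat_eq_0_iff_char_dvd[where ?'a = 'a] card_field by metis

lemma power_3n: "x \<noteq> 0 \<Longrightarrow> x ^ (3 * n) = (1::'a)"
  using power_CARD_minus_1[of x] card_field by simp

text \<open>Any noncube serves: 1, \<open>g\<close> and \<open>g\<^sup>2\<close> represent the three
  cosets of the cubes, and \<omega> is the value at \<open>g\<close> of the cubic residue character
  \<open>b ^ n\<close>.\<close>

definition g :: 'a where "g = (SOME y. y \<noteq> 0 \<and> y ^ n \<noteq> 1)"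
definition \<omega> :: 'a where "\<omega> = g ^ n"

lemma g_nonzero: "g \<noteq> 0" and omega_neq_1: "\<omega> \<noteq> 1"
proof -
  have "\<exists>y::'a. y \<noteq> 0 \<and> y ^ n \<noteq> 1"
    using ex_nonzero_power_neq_1[where ?'a = 'a, of n] n_gt_1 card_field by simp
  from someI_ex[OF this] show "g \<noteq> 0" "\<omega> \<noteq> 1" by (auto simp: g_def \<omega>_def)
qed

lemma omega_cube: "\<omega> ^ 3 = 1"
  using power_3n[OF g_nonzero] by (simp add: \<omega>_def mult.commute flip: power_mult)

lemma cube_root_of_unity_sum: "w ^ 3 = (1::'a) \<Longrightarrow> w \<noteq> 1 \<Longrightarrow> 1 + w + w\<^sup>2 = 0"
proof -
  assume w: "w ^ 3 = (1::'a)" "w \<noteq> 1"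
  have "(w - 1) * (1 + w + w\<^sup>2) = w ^ 3 - 1"
    by (simp add: power2_eq_square power3_eq_cube algebra_simps)
  then show ?thesis using w by simp
qed

lemma omega_sq: "1 + \<omega> + \<omega>\<^sup>2 = 0"
  using cube_root_of_unity_sum omega_cube omega_neq_1 by blast

lemma omega_distinct: "\<omega> \<noteq> 0" "\<omega>\<^sup>2 \<noteq> 1" "\<omega>\<^sup>2 \<noteq> \<omega>"
proof -
  show 0: "\<omega> \<noteq> 0" using omega_cube by auto
  show "\<omega>\<^sup>2 \<noteq> 1" using omega_cube omega_neq_1 by (auto simp: power2_eq_square power3_eq_cube)
  show "\<omega>\<^sup>2 \<noteq> \<omega>" using 0 omega_neq_1 by (auto simp: power2_eq_square)
qed

lemma cube_eq_iff: "x ^ 3 = y ^ 3 \<longleftrightarrow> x = y \<or> x = \<omega> * y \<or> x = \<omega>\<^sup>2 * (y::'a)"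
proof -
  have "(x - y) * ((x - \<omega> * y) * (x - \<omega>\<^sup>2 * y))
      = x ^ 3 - (1 + \<omega> + \<omega>\<^sup>2) * x\<^sup>2 * y + \<omega> * (1 + \<omega> + \<omega>\<^sup>2) * x * y\<^sup>2 - \<omega> ^ 3 * y ^ 3"
    by (simp add: power2_eq_square power3_eq_cube algebra_simps)
  then have "x ^ 3 - y ^ 3 = (x - y) * ((x - \<omega> * y) * (x - \<omega>\<^sup>2 * y))"
    by (simp add: omega_sq omega_cube)
  then have "x ^ 3 - y ^ 3 = 0 \<longleftrightarrow> x - y = 0 \<or> x - \<omega> * y = 0 \<or> x - \<omega>\<^sup>2 * y = 0"
    by (simp only: mult_eq_0_iff)
  then show ?thesis by simp
qed

lemma card_cube_roots: "y \<noteq> 0 \<Longrightarrow> card {x::'a. x ^ 3 = y ^ 3} = 3"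
proof -
  assume "y \<noteq> 0"
  have "{x::'a. x ^ 3 = y ^ 3} = {y, \<omega> * y, \<omega>\<^sup>2 * y}" using cube_eq_iff by auto
  moreover have "y \<noteq> \<omega> * y" "y \<noteq> \<omega>\<^sup>2 * y" "\<omega> * y \<noteq> \<omega>\<^sup>2 * y"
    using \<open>y \<noteq> 0\<close> omega_neq_1 omega_distinct by (metis mult_cancel_right mult_1)+
  ultimately show ?thesis by simp
qed

lemma zero_notin_cubes: "0 \<notin> R"
  by (auto simp: cubes_def)

text \<open>Cubing is three-to-one away from 0.\<close>

lemma sum_over_cubes:
  fixes f :: "'a \<Rightarrow> 'b::comm_semiring_1"
  shows "(\<Sum>x\<in>UNIV. f (x ^ 3)) = f 0 + 3 * (\<Sum>y\<in>R. f y)"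
proof -
  have "(\<Sum>x\<in>UNIV. f (x ^ 3)) = f 0 + (\<Sum>x\<in>UNIV - {0}. f (x ^ 3))"
    by (subst sum.remove[of UNIV 0]) auto
  also have "(\<Sum>x\<in>UNIV - {0}. f (x ^ 3)) = (\<Sum>y\<in>R. \<Sum>x\<in>{x \<in> UNIV - {0}. x ^ 3 = y}. f (x ^ 3))"
    by (rule sum.group[symmetric]) (auto simp: cubes_def)
  also have "\<dots> = (\<Sum>y\<in>R. 3 * f y)"
  proof (rule sum.cong[OF refl])
    fix y assume "y \<in> R"
    then obtain z where z: "z \<noteq> 0" "y = z ^ 3" by (auto simp: cubes_def)
    then have "{x \<in> UNIV - {0}. x ^ 3 = y} = {x. x ^ 3 = z ^ 3}" by (auto simp: zero_power)
    then show "(\<Sum>x\<in>{x \<in> UNIV - {0}. x ^ 3 = y}. f (x ^ 3)) = 3 * f y"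
      using card_cube_roots[OF z(1)] z(2) by simp
  qed
  finally show ?thesis by (simp add: sum_distrib_left)
qed

lemma card_cubes: "card R = n"
  using sum_over_cubes[of "\<lambda>_. 1::nat"] card_field by simp

text \<open>Euler's criterion for cubes: one inclusion suffices, because X^n - 1 has at most
  \<open>n = card R\<close> roots.\<close>

lemma cubes_eq: "R = {x. x ^ n = 1}"
proof (rule card_seteq)
  show "R \<subseteq> {x. x ^ n = 1}"
    using power_3n by (auto simp: cubes_def simp flip: power_mult)
  show "card {x::'a. x ^ n = 1} \<le> card R"
    using card_roots_of_unity_le[of n] n_gt_1 card_cubes by simp
qed auto

lemma minus_one_cube: "- 1 \<in> R"
proof -
  have "(- 1 :: 'a) = (- 1) ^ 3" by simp
  then show ?thesis unfolding cubes_def by (smt (verit) mem_Collect_eq neg_equal_0_iff_equal one_neq_zero)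
qed

lemma cubes_mult: "x \<in> R \<Longrightarrow> y \<in> R \<Longrightarrow> x * y \<in> R"
  by (simp add: cubes_eq power_mult_distrib)

lemma cubes_uminus: "- x \<in> R \<longleftrightarrow> x \<in> R"
  using cubes_mult[OF minus_one_cube, of x] cubes_mult[OF minus_one_cube, of "- x"] by auto

lemma cubes_divide: "x \<in> R \<Longrightarrow> y \<in> R \<Longrightarrow> x / y \<in> R"
  by (simp add: cubes_eq power_divide)

text \<open>A nonzero element of the prime field has (p-1)-st power 1, and
  \<open>prime_field_dvd\<close> carries this over to the exponent \<open>n\<close>.\<close>

lemma prime_field_cubes: "0 < k \<Longrightarrow> k < p \<Longrightarrow> of_nat k \<in> R"
proof -
  assume k: "0 < k" "k < p"
  then have "\<not> p dvd k" using nat_dvd_not_less by blast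
  then have nz: "of_nat k \<noteq> (0::'a)" by (simp add: of_nat_eq_0_iff_p)
  have "of_nat k ^ p = (of_nat k :: 'a)"
    using prime_field_eq[OF prime_p char_p] k by auto
  then have "of_nat k * of_nat k ^ (p - 1) = (of_nat k :: 'a)"
    using p_gt_1 by (simp flip: power_Suc)
  then have "of_nat k ^ (p - 1) = (1::'a)" using nz by simp
  then have "of_nat k ^ n = (1::'a)"
    using prime_field_dvd by (auto elim!: dvdE simp: power_mult)
  then show ?thesis by (simp add: cubes_eq)
qed

lemma coset_eq: "{b. b ^ n = \<omega> ^ i} = (\<lambda>r. g ^ i * r) ` R"
proof (intro equalityI subsetI)
  fix b assume "b \<in> {b. b ^ n = \<omega> ^ i}"
  then have "b / g ^ i \<in> R"
    using g_nonzero by (simp add: cubes_eq power_divide \<omega>_def mult.commute flip: power_mult)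
  then show "b \<in> (\<lambda>r. g ^ i * r) ` R"
    using g_nonzero by (intro image_eqI[of _ _ "b / g ^ i"]) auto
next
  fix b assume "b \<in> (\<lambda>r. g ^ i * r) ` R"
  then show "b \<in> {b. b ^ n = \<omega> ^ i}"
    by (auto simp: cubes_eq power_mult_distrib \<omega>_def mult.commute simp flip: power_mult)
qed

text \<open>The fibres of \<open>b ^ n\<close> over 1, \<omega> and \<open>\<omega>\<^sup>2\<close>
  are cosets with \<open>n\<close> elements each; this is the source of the multiplicities in the
  spectrum.\<close>

lemma image_mset_coset_invariant:
  assumes inv: "\<And>b r. r \<in> R \<Longrightarrow> f (b * r) = f b"
  shows "image_mset f (mset_set (UNIV - {0})) =
    replicate_mset n (f 1) + replicate_mset n (f g) + replicate_mset n (f (g\<^sup>2))"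
proof -
  let ?C = "\<lambda>i. {b. b ^ n = \<omega> ^ i}"
  have C: "image_mset f (mset_set (?C i)) = replicate_mset n (f (g ^ i))" for i
  proof -
    have inj: "inj_on (\<lambda>r. g ^ i * r) R" using g_nonzero by (auto intro!: inj_onI)
    have "image_mset f (mset_set (?C i)) = image_mset f (image_mset (\<lambda>r. g ^ i * r) (mset_set R))"
      unfolding coset_eq using image_mset_mset_set[OF inj] by simp
    also have "\<dots> = image_mset (\<lambda>r. f (g ^ i)) (mset_set R)"
      unfolding image_mset.compositionality
      by (intro image_mset_cong) (use inv in auto)
    finally show ?thesis by (simp add: image_mset_const_eq card_cubes)
  qed
  have "b ^ n \<in> {1, \<omega>, \<omega>\<^sup>2}" if "b \<noteq> 0" for b
    using cube_eq_iff[of "b ^ n" 1] power_3n[OF that] by (auto simp: mult.commute simp flip: power_mult)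
  then have "UNIV - {0} = ?C 0 \<union> ?C 1 \<union> ?C 2"
    using n_gt_1 omega_distinct by (auto simp: zero_power)
  moreover have "?C 0 \<inter> ?C 1 = {}" "(?C 0 \<union> ?C 1) \<inter> ?C 2 = {}"
    using omega_neq_1 omega_distinct by auto
  ultimately have "mset_set (UNIV - {0}) = mset_set (?C 0) + mset_set (?C 1) + mset_set (?C 2)"
    by (simp only: mset_set_Union finite)
  then show ?thesis using C[of 0] C[of 1] C[of 2] by simp
qed

lemma sum_coset_invariant:
  fixes f :: "'a \<Rightarrow> 'b::comm_semiring_1"
  assumes "\<And>b r. r \<in> R \<Longrightarrow> f (b * r) = f b"
  shows "(\<Sum>b\<in>UNIV. f b) = f 0 + of_nat n * (f 1 + f g + f (g\<^sup>2))"
proof -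
  have "image_mset f (mset_set (UNIV - {0})) =
      replicate_mset n (f 1) + replicate_mset n (f g) + replicate_mset n (f (g\<^sup>2))"
    by (rule image_mset_coset_invariant) (rule assms)
  then have "sum f (UNIV - {0}) = of_nat n * (f 1 + f g + f (g\<^sup>2))"
    unfolding sum_unfold_sum_mset by (simp add: distrib_left)
  then show ?thesis by (subst sum.remove[of UNIV 0]) auto
qed

section \<open>The additive character, its periods and the spectrum\<close>

definition \<zeta> :: complex where "\<zeta> = exp (2 * of_real pi * \<i> / of_nat p)"
definition \<psi> :: "'a \<Rightarrow> complex" where "\<psi> x = \<zeta> ^ T x"

lemma zeta_power: "\<zeta> ^ k = exp (2 * of_real pi * \<i> * of_nat k / of_nat p)"
  by (simp add: \<zeta>_def mult_ac flip: exp_of_nat_mult)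

lemma zeta_power_eq_1: "\<zeta> ^ k = 1 \<longleftrightarrow> p dvd k"
  unfolding zeta_power using complex_root_unity_eq_1[of p k] p_gt_1 by simp

lemma zeta_power_mod: "\<zeta> ^ (k mod p) = \<zeta> ^ k"
proof -
  have "\<zeta> ^ k = \<zeta> ^ (p * (k div p) + k mod p)" by simp
  also have "\<dots> = \<zeta> ^ (k mod p)"
    unfolding power_add power_mult using zeta_power_eq_1[of p] by simp
  finally show ?thesis ..
qed

lemma psi_add: "\<psi> (x + y) = \<psi> x * \<psi> y"
  by (simp add: \<psi>_def T_add zeta_power_mod power_add)

lemma psi_nonzero: "\<psi> x \<noteq> 0"
  by (simp add: \<psi>_def \<zeta>_def)

lemma psi_0: "\<psi> 0 = 1"
  using psi_add[of 0 0] psi_nonzero[of 0] by simp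

lemma norm_psi: "norm (\<psi> x) = 1"
  by (simp add: \<psi>_def \<zeta>_def norm_power)

lemma psi_uminus: "\<psi> (- x) = cnj (\<psi> x)"
proof -
  have "\<psi> x * \<psi> (- x) = 1" using psi_add[of x "- x"] psi_0 by simp
  moreover have "\<psi> x * cnj (\<psi> x) = 1" using complex_norm_square[of "\<psi> x"] norm_psi[of x] by simp
  ultimately show ?thesis using psi_nonzero[of x] by (metis mult_left_cancel)
qed

text \<open>For nonzero \<open>b\<close>, translating \<open>x\<close> by \<open>z / b\<close>
  multiplies the sum by \<open>\<psi> z\<close>, and \<open>z\<close> can be chosen so that this is
  not 1.\<close>

lemma sum_psi: "(\<Sum>x\<in>UNIV. \<psi> (x * b)) = (if b = 0 then of_nat card_F else 0)"
proof (cases "b = 0")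
  case True
  then show ?thesis by (simp add: psi_0 card_field)
next
  case False
  obtain z where "T z \<noteq> 0" using T_nontrivial by blast
  then have z: "\<psi> z \<noteq> 1"
    using T_less[of z] nat_dvd_not_less by (auto simp: \<psi>_def zeta_power_eq_1)
  have "(\<Sum>x\<in>UNIV. \<psi> (x * b)) = (\<Sum>x\<in>UNIV. \<psi> ((x + z / b) * b))"
    by (rule sum.reindex_bij_witness[of _ "\<lambda>x. x + z / b" "\<lambda>x. x - z / b"]) auto
  moreover have "\<psi> ((x + z / b) * b) = \<psi> z * \<psi> (x * b)" for x
    using False psi_add[of z "x * b"] by (simp add: distrib_right add.commute)
  then have "(\<Sum>x\<in>UNIV. \<psi> ((x + z / b) * b)) = \<psi> z * (\<Sum>x\<in>UNIV. \<psi> (x * b))"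
    by (simp add: sum_distrib_left)
  ultimately have "(1 - \<psi> z) * (\<Sum>x\<in>UNIV. \<psi> (x * b)) = 0" by (simp add: algebra_simps)
  then show ?thesis using z False by simp
qed

lemma T_mult: "T (of_nat k * x) = k * T x mod p"
proof (induction k)
  case 0
  have "T 0 = (T 0 + T 0) mod p" using T_add[of 0 0] by simp
  \<comment> \<open>Without reduction \<open>T 0 = 2 * T 0\<close>; with reduction
    \<open>T 0 = 2 * T 0 - p\<close>, which would make \<open>T 0\<close> equal to
    \<open>p\<close>.\<close>
  then have "T 0 = 0"
    using T_less[of 0] by (cases "T 0 + T 0 < p") (auto simp: le_mod_geq)
  then show ?case by simp
next
  case (Suc k)
  then show ?case by (simp add: distrib_right T_add mod_simps)
qed

text \<open>The cubic Gaussian period, which is the eigenvalue belonging to the character with index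
  \<open>b\<close>.\<close>

definition \<eta> :: "'a \<Rightarrow> complex" where "\<eta> b = (\<Sum>x\<in>R. \<psi> (b * x))"

lemma eta_mult_cube: "r \<in> R \<Longrightarrow> \<eta> (b * r) = \<eta> b"
  unfolding \<eta>_def using zero_notin_cubes
  by (intro sum.reindex_bij_witness[of _ "\<lambda>x. x / r" "\<lambda>x. r * x"])
    (auto simp: cubes_mult cubes_divide mult.assoc)

lemma eta_0: "\<eta> 0 = of_nat n"
  by (simp add: \<eta>_def psi_0 card_cubes)

text \<open>The nonzero elements of the prime field are cubes, so \<open>T (b * x)\<close> takes every nonzero value
  equally often as \<open>x\<close> runs through the cubes.\<close>

lemma eta_int: "\<exists>k::int. \<eta> b = of_int k"
proof -
  define Z where "Z j = card {x \<in> R. T (b * x) = j}" for j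
  have Z: "Z j = Z 1" if j: "j \<in> {1..<p}" for j
  proof -
    have "coprime j p" using j prime_p by (metis atLeastLessThan_iff coprime_commute nat_dvd_not_less prime_imp_coprime less_le_trans zero_less_one)
    \<comment> \<open>Multiplication by \<open>j\<close> and by its inverse modulo \<open>p\<close>
      are mutually inverse maps of the cubes, and they exchange the level sets of
      \<open>T (b * x)\<close> at 1 and \<open>j\<close>.\<close>
    then obtain i where i: "[j * i = 1] (mod p)" using cong_solve_coprime_nat by auto
    define i' where "i' = i mod p"
    have i1: "j * i' mod p = 1" using i p_gt_1 by (simp add: i'_def cong_def mod_simps)
    then have "i' \<noteq> 0" by (intro notI) simp
    then have i': "0 < i'" "i' < p" using p_gt_1 by (auto simp: i'_def)
    have inv: "of_nat j * of_nat i' = (1::'a)"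
      using i1 p_gt_1 by (metis char_p cong_def of_nat_1 of_nat_eq_iff_cong_CHAR of_nat_mult mod_less)
    have jR: "of_nat j \<in> R" "of_nat i' \<in> R" using prime_field_cubes j i' by auto
    have Tj: "T (b * (of_nat j * x)) = j" if "T (b * x) = 1" for x
      using T_mult[of j "b * x"] that j by (simp add: mult.left_commute)
    have Ti: "T (b * (of_nat i' * x)) = 1" if "T (b * x) = j" for x
      using T_mult[of i' "b * x"] that i1 by (simp add: mult.left_commute mult.commute)
    have "bij_betw (\<lambda>x. of_nat j * x) {x \<in> R. T (b * x) = 1} {x \<in> R. T (b * x) = j}"
    proof (rule bij_betw_byWitness[where f' = "\<lambda>x. of_nat i' * x"])
      show "\<forall>a\<in>{x \<in> R. T (b * x) = 1}. of_nat i' * (of_nat j * a) = a"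
        using inv by (metis mult.assoc mult.commute mult_1)
      show "\<forall>a'\<in>{x \<in> R. T (b * x) = j}. of_nat j * (of_nat i' * a') = a'"
        using inv by (metis mult.assoc mult_1)
      show "(\<lambda>x. of_nat j * x) ` {x \<in> R. T (b * x) = 1} \<subseteq> {x \<in> R. T (b * x) = j}"
        using jR Tj by (auto simp: cubes_mult)
      show "(\<lambda>x. of_nat i' * x) ` {x \<in> R. T (b * x) = j} \<subseteq> {x \<in> R. T (b * x) = 1}"
        using jR Ti by (auto simp: cubes_mult)
    qed
    then have "card {x \<in> R. T (b * x) = 1} = card {x \<in> R. T (b * x) = j}"
      by (rule bij_betw_same_card)
    then show ?thesis unfolding Z_def by (rule sym)
  qed
  have "\<eta> b = (\<Sum>j\<in>{..<p}. \<Sum>x\<in>{x \<in> R. T (b * x) = j}. \<psi> (b * x))"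
    unfolding \<eta>_def by (rule sum.group[symmetric]) (use T_less in auto)
  also have "\<dots> = (\<Sum>j\<in>{..<p}. of_nat (Z j) * \<zeta> ^ j)"
    by (intro sum.cong) (auto simp: \<psi>_def Z_def)
  also have "{..<p} = insert 0 {1..<p}" using p_gt_1 by auto
  also have "(\<Sum>j\<in>insert 0 {1..<p}. of_nat (Z j) * \<zeta> ^ j) = of_nat (Z 0) + (\<Sum>j\<in>{1..<p}. of_nat (Z j) * \<zeta> ^ j)"
    by simp
  also have "(\<Sum>j\<in>{1..<p}. of_nat (Z j) * \<zeta> ^ j) = (\<Sum>j\<in>{1..<p}. of_nat (Z 1) * \<zeta> ^ j)"
    by (rule sum.cong[OF refl]) (subst Z, auto)
  also have "\<dots> = of_nat (Z 1) * (\<Sum>j\<in>{1..<p}. \<zeta> ^ j)"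
    by (rule sum_distrib_left[symmetric])
  \<comment> \<open>All p-th roots of unity sum to 0, so the period becomes
    \<open>Z 0 - Z 1\<close>.\<close>
  also have "(\<Sum>j\<in>{1..<p}. \<zeta> ^ j) = - 1"
  proof -
    have "\<zeta> \<noteq> 1" using zeta_power_eq_1[of 1] p_gt_1 by simp
    then have "(\<Sum>j\<in>{..<p}. \<zeta> ^ j) = 0"
      using zeta_power_eq_1[of p] by (simp add: geometric_sum)
    moreover have "{..<p} = insert 0 {1..<p}" using p_gt_1 by auto
    ultimately show ?thesis by (simp add: add_eq_0_iff)
  qed
  finally have "\<eta> b = of_int (int (Z 0) - int (Z 1))" by simp
  then show ?thesis by blast
qed

definition h :: "'a \<Rightarrow> int" where "h b = (SOME k. \<eta> b = of_int k)"

lemma eta_eq: "\<eta> b = of_int (h b)"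
  unfolding h_def using eta_int[of b] by (rule someI_ex)

lemma h_0: "h 0 = int n"
  using eta_eq[of 0] eta_0 by (metis of_int_eq_iff of_int_of_nat_eq)

lemma h_mult_cube: "r \<in> R \<Longrightarrow> h (b * r) = h b"
  using eta_eq eta_mult_cube by (metis of_int_eq_iff)

lemma spectrum_multiset:
  "is_spectrum (adj_matrix (cayley3 :: 'a \<Rightarrow> 'a \<Rightarrow> bool))
    ({#real n#} + replicate_mset n (of_int (h 1)) + replicate_mset n (of_int (h g))
      + replicate_mset n (of_int (h (g\<^sup>2))))"
proof -
  \<comment> \<open>The Hartley kernel (cos + sin) gives a real eigenbasis because the periods are real.\<close>
  define H where "H u b = Re (\<psi> (u * b)) + Im (\<psi> (u * b))" for u b
  have "is_spectrum (adj_matrix (cayley3 :: 'a \<Rightarrow> 'a \<Rightarrow> bool)) (image_mset (\<lambda>b. of_int (h b)) (mset_set UNIV))"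
  proof (rule is_spectrum_if_orthogonal_eigenbasis[where H = H and c = "real card_F"])
    fix u b
    have "(\<Sum>v\<in>UNIV. adj_matrix cayley3 $ u $ v * H v b) = (\<Sum>v\<in>{v. v - u \<in> R}. H v b)"
      by (intro sum.mono_neutral_cong_right) (auto simp: adj_matrix_def cayley3_def)
    also have "\<dots> = (\<Sum>x\<in>R. H (u + x) b)"
      by (rule sum.reindex_bij_witness[of _ "\<lambda>x. u + x" "\<lambda>v. v - u"]) auto
    \<comment> \<open>A shift by \<open>x\<close> multiplies the character by
      \<open>\<psi> (b * x)\<close>, and these factors sum to the period. As the period is real, it
      scales real and imaginary parts alike.\<close>
    also have "\<dots> = Re (\<psi> (u * b) * \<eta> b) + Im (\<psi> (u * b) * \<eta> b)"
    proof -
      have "\<psi> (u * b) * \<eta> b = (\<Sum>x\<in>R. \<psi> ((u + x) * b))"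
        unfolding \<eta>_def sum_distrib_left
        by (intro sum.cong refl) (simp add: distrib_right psi_add mult.commute[of b])
      then show ?thesis by (simp add: H_def sum.distrib)
    qed
    also have "\<dots> = of_int (h b) * H u b"
      by (simp add: eta_eq H_def algebra_simps)
    finally show "(\<Sum>v\<in>UNIV. adj_matrix cayley3 $ u $ v * H v b) = of_int (h b) * H u b" .
  next
    fix u v
    \<comment> \<open>The product of cos + sin at two angles is the cosine of the difference plus
      the sine of the sum.\<close>
    have "H u b * H v b = Re (\<psi> (b * (u - v))) + Im (\<psi> (b * (u + v)))" for b
    proof -
      have "\<psi> (b * (u - v)) = \<psi> (u * b) * cnj (\<psi> (v * b))"
        using psi_add[of "u * b" "- (v * b)"] by (simp add: psi_uminus algebra_simps)
      moreover have "\<psi> (b * (u + v)) = \<psi> (u * b) * \<psi> (v * b)"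
        using psi_add[of "u * b" "v * b"] by (simp add: algebra_simps)
      ultimately show ?thesis by (simp add: H_def algebra_simps)
    qed
    then have "(\<Sum>b\<in>UNIV. H u b * H v b) =
        Re (\<Sum>b\<in>UNIV. \<psi> (b * (u - v))) + Im (\<Sum>b\<in>UNIV. \<psi> (b * (u + v)))"
      by (simp add: sum.distrib)
    then show "(\<Sum>b\<in>UNIV. H u b * H v b) = (if u = v then real card_F else 0)"
      by (simp add: sum_psi)
  qed simp
  moreover have "mset_set (UNIV::'a set) = add_mset 0 (mset_set (UNIV - {0}))"
    by (metis UNIV_I finite mset_set.remove)
  ultimately show ?thesis
    using image_mset_coset_invariant[of "\<lambda>b. of_int (h b) :: real"] h_mult_cube
    by (simp add: h_0)
qed

section \<open>Moments of the cubic sums and point counts\<close>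

text \<open>The exponential sum of \<open>\<psi> (b * x ^ 3)\<close> over the whole field: 0
  contributes 1 and each nonzero cube occurs three times.\<close>

definition \<theta> :: "'a \<Rightarrow> int" where "\<theta> b = 1 + 3 * h b"

lemma theta_0: "\<theta> 0 = int card_F"
  by (simp add: \<theta>_def h_0)

lemma theta_mult_cube: "r \<in> R \<Longrightarrow> \<theta> (b * r) = \<theta> b"
  by (simp add: \<theta>_def h_mult_cube)

lemma theta_mod_3: "\<theta> b mod 3 = 1"
  by (simp add: \<theta>_def)

lemma theta_eq: "of_int (\<theta> b) = (\<Sum>x\<in>UNIV. \<psi> (b * x ^ 3))"
  using sum_over_cubes[of "\<lambda>y. \<psi> (b * y)"] eta_eq[of b] by (simp add: \<theta>_def \<eta>_def psi_0)

text \<open>Orthogonality as a counting device. The index type may be a product, so that powers of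
  \<theta> count solutions in several variables.\<close>

lemma sum_sum_psi:
  fixes f :: "'c::finite \<Rightarrow> 'a"
  shows "(\<Sum>b\<in>UNIV. \<Sum>s\<in>UNIV. \<psi> (b * f s)) = of_nat (card_F * card {s. f s = 0})"
proof -
  have "(\<Sum>b\<in>UNIV. \<Sum>s\<in>UNIV. \<psi> (b * f s)) = (\<Sum>s\<in>UNIV. \<Sum>b\<in>UNIV. \<psi> (b * f s))"
    by (rule sum.swap)
  also have "\<dots> = (\<Sum>s\<in>UNIV. if f s = 0 then of_nat card_F else 0)"
    by (intro sum.cong refl sum_psi)
  also have "\<dots> = (\<Sum>s\<in>{s. f s = 0}. of_nat card_F)"
    by (intro sum.mono_neutral_cong_right) auto
  finally show ?thesis by (simp add: algebra_simps)
qed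

definition W :: "'a \<Rightarrow> nat" where "W u = card {(x, y). x ^ 3 + y ^ 3 = u}"

lemma sum_theta: "(\<Sum>b\<in>UNIV. \<theta> b) = int card_F"
proof -
  have "complex_of_int (\<Sum>b\<in>UNIV. \<theta> b) = of_nat (card_F * card {x::'a. x ^ 3 = 0})"
    unfolding of_int_sum theta_eq by (rule sum_sum_psi)
  also have "{x::'a. x ^ 3 = 0} = {0}" by auto
  finally have "complex_of_int (\<Sum>b\<in>UNIV. \<theta> b) = of_int (int card_F)" by simp
  then show ?thesis by (simp only: of_int_eq_iff)
qed

lemma sum_theta_sq: "(\<Sum>b\<in>UNIV. \<theta> b ^ 2) = int (card_F * W 0)"
proof -
  have "of_int (\<theta> b) ^ 2 = (\<Sum>s\<in>UNIV. \<psi> (b * (case s of (x, y) \<Rightarrow> x ^ 3 + y ^ 3)))" for b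
    unfolding theta_eq power2_eq_square sum_product sum.cartesian_product UNIV_Times_UNIV
    by (intro sum.cong refl) (auto simp: distrib_left psi_add)
  then have "complex_of_int (\<Sum>b\<in>UNIV. \<theta> b ^ 2) =
      of_nat (card_F * card {s. (case s of (x, y) \<Rightarrow> x ^ 3 + y ^ 3) = (0::'a)})"
    by (simp only: of_int_sum of_int_power sum_sum_psi)
  also have "{s. (case s of (x, y) \<Rightarrow> x ^ 3 + y ^ 3) = (0::'a)} = {(x, y). x ^ 3 + y ^ 3 = 0}" by auto
  finally have "complex_of_int (\<Sum>b\<in>UNIV. \<theta> b ^ 2) = of_int (int (card_F * W 0))" by (simp add: W_def)
  then show ?thesis by (simp only: of_int_eq_iff)
qed

lemma sum_theta_cube: "(\<Sum>b\<in>UNIV. \<theta> b ^ 3) = int (card_F * (\<Sum>z\<in>UNIV. W (- (z ^ 3))))"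
proof -
  have "of_int (\<theta> b) ^ 3 = (\<Sum>s\<in>UNIV. \<psi> (b * (case s of (z, x, y) \<Rightarrow> z ^ 3 + (x ^ 3 + y ^ 3))))" for b
  proof -
    have "(of_int (\<theta> b) :: complex) ^ 3 = of_int (\<theta> b) * (of_int (\<theta> b) * of_int (\<theta> b))"
      by (simp add: power3_eq_cube)
    also have "\<dots> = (\<Sum>s\<in>UNIV. \<psi> (b * (case s of (z, x, y) \<Rightarrow> z ^ 3 + (x ^ 3 + y ^ 3))))"
      unfolding theta_eq sum_product sum.cartesian_product UNIV_Times_UNIV
      unfolding sum_distrib_left
      unfolding sum.cartesian_product UNIV_Times_UNIV
      by (intro sum.cong refl) (auto simp: distrib_left psi_add)
    finally show ?thesis .
  qed
  then have "complex_of_int (\<Sum>b\<in>UNIV. \<theta> b ^ 3) =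
      of_nat (card_F * card {s. (case s of (z, x, y) \<Rightarrow> z ^ 3 + (x ^ 3 + y ^ 3)) = (0::'a)})"
    by (simp only: of_int_sum of_int_power sum_sum_psi)
  also have "{s. (case s of (z, x, y) \<Rightarrow> z ^ 3 + (x ^ 3 + y ^ 3)) = (0::'a)} =
      (SIGMA z:UNIV. {(x, y). x ^ 3 + y ^ 3 = - (z ^ 3)})"
    by (auto simp: eq_neg_iff_add_eq_0 add.commute)
  also have "card \<dots> = (\<Sum>z\<in>UNIV. W (- (z ^ 3)))" by (simp add: W_def card_SigmaI)
  finally have "complex_of_int (\<Sum>b\<in>UNIV. \<theta> b ^ 3) = of_int (int (card_F * (\<Sum>z\<in>UNIV. W (- (z ^ 3)))))"
    by (simp only: of_int_of_nat_eq)
  then show ?thesis by (simp only: of_int_eq_iff)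
qed

lemma W_eq: "W u = (\<Sum>x\<in>UNIV. card {y. y ^ 3 = u - x ^ 3})"
proof -
  have "{(x, y). x ^ 3 + y ^ 3 = u} = (SIGMA x:UNIV. {y. y ^ 3 = u - x ^ 3})"
    by (auto simp: algebra_simps)
  then show ?thesis by (simp add: W_def card_SigmaI)
qed

lemma W_0: "W 0 = 1 + 9 * n"
proof -
  have "card {y. y ^ 3 = 0 - x ^ 3} = (if x = 0 then 1 else 3)" for x :: 'a
  proof (cases "x = 0")
    case True
    then have "{y. y ^ 3 = 0 - x ^ 3} = {0}" by auto
    then show ?thesis using True by simp
  next
    case False
    then show ?thesis using card_cube_roots[of "- x"] by simp
  qed
  then have "W 0 = (\<Sum>x\<in>UNIV. if x = (0::'a) then 1 else 3)" by (simp add: W_eq)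
  also have "\<dots> = 1 + (\<Sum>x\<in>UNIV - {0::'a}. 3)"
    by (subst sum.remove[of UNIV 0]) auto
  finally show ?thesis using card_field by simp
qed

text \<open>Scaling both coordinates by \<open>- z\<close> carries one curve to the other.\<close>

lemma W_minus_cube: "z \<noteq> 0 \<Longrightarrow> W (- (z ^ 3)) = W 1"
proof -
  assume z: "z \<noteq> 0"
  have "bij_betw (\<lambda>(x, y). (- z * x, - z * y)) {(x, y). x ^ 3 + y ^ 3 = 1} {(x, y). x ^ 3 + y ^ 3 = - (z ^ 3)}"
  proof (rule bij_betw_byWitness[where f' = "\<lambda>(x, y). (x / - z, y / - z)"])
    have "(- z * x) ^ 3 + (- z * y) ^ 3 = - (z ^ 3) * (x ^ 3 + y ^ 3)" for x y :: 'a
      by (simp add: power3_eq_cube algebra_simps)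
    then show "(\<lambda>(x, y). (- z * x, - z * y)) ` {(x, y). x ^ 3 + y ^ 3 = 1} \<subseteq> {(x, y). x ^ 3 + y ^ 3 = - (z ^ 3)}"
      by auto
    have "(x / - z) ^ 3 + (y / - z) ^ 3 = (x ^ 3 + y ^ 3) / - (z ^ 3)" for x y :: 'a
      by (simp add: power_divide add_divide_distrib power3_eq_cube)
    then show "(\<lambda>(x, y). (x / - z, y / - z)) ` {(x, y). x ^ 3 + y ^ 3 = - (z ^ 3)} \<subseteq> {(x, y). x ^ 3 + y ^ 3 = 1}"
      using z by auto
  qed (use z in auto)
  then show ?thesis unfolding W_def by (rule bij_betw_same_card[symmetric])
qed

text \<open>The projective curve x^3 + y^3 = z^3 has \<open>W 1 + 3\<close> points, three of them at
  infinity, so this is its deviation from \<open>card_F + 1\<close>.\<close>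

definition c :: int where "c = int (W 1) + 2 - int card_F"

text \<open>Each moment splits into the contribution \<open>card_F ^ k\<close> of 0 and
  \<open>n\<close> times a power sum over the three cosets. Equating it with the point count and
  cancelling \<open>n\<close> gives the power sums; when the sum is 0, the sum of cubes is three
  times the product.\<close>

lemma theta_relations:
  shows theta_sum: "\<theta> 1 + \<theta> g + \<theta> (g\<^sup>2) = 0"
    and theta_sum_sq: "\<theta> 1 ^ 2 + \<theta> g ^ 2 + \<theta> (g\<^sup>2) ^ 2 = 6 * int card_F"
    and theta_prod: "\<theta> 1 * \<theta> g * \<theta> (g\<^sup>2) = int card_F * c"
proof -
  have S: "(\<Sum>b\<in>UNIV. \<theta> b ^ k) = int card_F ^ k + int n * (\<theta> 1 ^ k + \<theta> g ^ k + \<theta> (g\<^sup>2) ^ k)" for k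
    using sum_coset_invariant[of "\<lambda>b. \<theta> b ^ k"] theta_mult_cube theta_0 by simp
  have n0: "int n \<noteq> 0" using n_gt_1 by simp
  show 1: "\<theta> 1 + \<theta> g + \<theta> (g\<^sup>2) = 0"
    using S[of 1] sum_theta n0 by simp
  have "int n * (\<theta> 1 ^ 2 + \<theta> g ^ 2 + \<theta> (g\<^sup>2) ^ 2) = int n * (6 * int card_F)"
    using S[of 2] sum_theta_sq unfolding W_0 by (simp add: power2_eq_square algebra_simps)
  then show "\<theta> 1 ^ 2 + \<theta> g ^ 2 + \<theta> (g\<^sup>2) ^ 2 = 6 * int card_F"
    using n0 by (simp only: mult_cancel_left) simp
  have "(\<Sum>z\<in>UNIV. W (- (z ^ 3))) = W 0 + (\<Sum>z\<in>UNIV - {0::'a}. W 1)"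
    by (subst sum.remove[of UNIV 0]) (auto simp: W_minus_cube)
  also have "\<dots> = 1 + 9 * n + 3 * n * W 1" using card_field W_0 by simp
  finally have W: "(\<Sum>z\<in>UNIV. W (- (z ^ 3))) = 1 + 9 * n + 3 * n * W 1" .
  have "int n * (\<theta> 1 ^ 3 + \<theta> g ^ 3 + \<theta> (g\<^sup>2) ^ 3) = int n * (3 * (int card_F * c))"
    using S[of 3] sum_theta_cube unfolding W c_def by (simp add: power3_eq_cube algebra_simps)
  then have 3: "\<theta> 1 ^ 3 + \<theta> g ^ 3 + \<theta> (g\<^sup>2) ^ 3 = 3 * (int card_F * c)"
    using n0 by (simp only: mult_cancel_left) simp
  have z: "\<theta> (g\<^sup>2) = - \<theta> 1 - \<theta> g" using 1 by simp
  have "3 * (\<theta> 1 * \<theta> g * \<theta> (g\<^sup>2)) = \<theta> 1 ^ 3 + \<theta> g ^ 3 + \<theta> (g\<^sup>2) ^ 3"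
    unfolding z by (simp add: power3_eq_cube algebra_simps)
  then show "\<theta> 1 * \<theta> g * \<theta> (g\<^sup>2) = int card_F * c" using 3 by simp
qed

section \<open>The constant c modulo p\<close>

text \<open>For nonzero \<open>u\<close> the value \<open>u ^ n\<close> is a cube root of unity; the
  right side is 3 if it is 1 and 0 otherwise.\<close>

lemma of_nat_card_cube_roots: "of_nat (card {y. y ^ 3 = u}) = (1 + u ^ n + u ^ (2 * n) :: 'a)"
proof -
  consider "u = 0" | "u \<in> R" | "u \<noteq> 0" "u \<notin> R" by blast
  then show ?thesis
  proof cases
    case 1
    then have "{y. y ^ 3 = u} = {0}" by auto
    then show ?thesis using 1 n_gt_1 by (simp add: zero_power)
  next
    case 2
    then obtain y where "y \<noteq> 0" "u = y ^ 3" by (auto simp: cubes_def)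
    then have "card {y. y ^ 3 = u} = 3" using card_cube_roots by blast
    moreover have "u ^ n = 1" using 2 by (simp add: cubes_eq)
    moreover have "u ^ (2 * n) = (u ^ n) ^ 2" by (simp add: mult.commute flip: power_mult)
    ultimately show ?thesis by simp
  next
    case 3
    then have "y ^ 3 \<noteq> u" for y by (auto simp: cubes_def)
    then have "{y. y ^ 3 = u} = {}" by simp
    moreover have "u ^ n \<noteq> 1" using 3 by (simp add: cubes_eq)
    moreover have "(u ^ n) ^ 3 = 1" using power_3n[OF 3(1)] by (simp add: mult.commute flip: power_mult)
    moreover have "u ^ (2 * n) = (u ^ n) ^ 2" by (simp add: mult.commute flip: power_mult)
    ultimately show ?thesis using cube_root_of_unity_sum[of "u ^ n"] by simp
  qed
qed

text \<open>After binomial expansion only exponents \<open>3 * j\<close> divisible by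
  \<open>3 * n\<close> survive. The term \<open>j = 0\<close> contributes the field size, which is 0
  in the field.\<close>

lemma sum_one_minus_cube_power:
  "(\<Sum>x\<in>UNIV. (1 - x ^ 3) ^ N) = - (\<Sum>j | 0 < j \<and> j \<le> N \<and> n dvd j. of_nat (N choose j) * (- 1) ^ j :: 'a)"
proof -
  have S: "(\<Sum>x\<in>UNIV. x ^ (3 * j)) = (if 0 < j \<and> n dvd j then - 1 else (0::'a))" for j
  proof (cases "j = 0")
    case True
    then show ?thesis using of_nat_q card_field by simp
  next
    case False
    then show ?thesis using sum_powers_finite_field[where ?'a = 'a, of "3 * j"] card_field by simp
  qed
  have "(1 - x ^ 3) ^ N = (\<Sum>j\<le>N. of_nat (N choose j) * (- 1) ^ j * x ^ (3 * j))" for x :: 'a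
  proof -
    have "(1 - x ^ 3) ^ N = (- (x ^ 3) + 1) ^ N" by simp
    also have "\<dots> = (\<Sum>j\<le>N. of_nat (N choose j) * (- (x ^ 3)) ^ j * 1 ^ (N - j))" by (rule binomial_ring)
    also have "\<dots> = (\<Sum>j\<le>N. of_nat (N choose j) * (- 1) ^ j * x ^ (3 * j))"
      by (intro sum.cong refl) (simp add: power_minus[of "x ^ 3"] power_mult mult.assoc)
    finally show ?thesis .
  qed
  then have "(\<Sum>x\<in>UNIV. (1 - x ^ 3) ^ N) = (\<Sum>x\<in>UNIV. \<Sum>j\<le>N. of_nat (N choose j) * (- 1) ^ j * x ^ (3 * j) :: 'a)"
    by simp
  also have "\<dots> = (\<Sum>j\<le>N. \<Sum>x\<in>UNIV. of_nat (N choose j) * (- 1) ^ j * x ^ (3 * j))" by (rule sum.swap)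
  also have "\<dots> = (\<Sum>j\<le>N. of_nat (N choose j) * (- 1) ^ j * (if 0 < j \<and> n dvd j then - 1 else 0))"
    by (simp only: S flip: sum_distrib_left)
  also have "\<dots> = (\<Sum>j | 0 < j \<and> j \<le> N \<and> n dvd j. - (of_nat (N choose j) * (- 1) ^ j))"
    by (intro sum.mono_neutral_cong_right) auto
  finally show ?thesis by (simp add: sum_negf)
qed

text \<open>In the field, the number of cube roots of \<open>u\<close> is \<open>1 + u\<^sup>n + u\<^sup>2\<^sup>n\<close>, so the point count \<open>W 1\<close> becomes a sum
  of powers of \<open>1 - x\<^sup>3\<close>, in which only the exponents divisible by \<open>q - 1\<close> survive.\<close>

lemma dvd_c_iff: "int p dvd c \<longleftrightarrow> p dvd (2 * n choose n)"
proof -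
  have m1: "(- 1 :: 'a) ^ n = 1" using minus_one_cube by (simp add: cubes_eq)
  have n0: "n > 0" using n_gt_1 by simp
  have "{j. 0 < j \<and> j \<le> n \<and> n dvd j} = {n}"
    using n0 by (auto dest: dvd_imp_le)
  then have 1: "(\<Sum>x\<in>UNIV. (1 - x ^ 3) ^ n) = (- 1 :: 'a)"
    using sum_one_minus_cube_power[of n] m1 by simp
  have "j = n \<or> j = 2 * n" if "0 < j" "j \<le> 2 * n" "n dvd j" for j
  proof -
    from that(3) obtain k where k: "j = n * k" by (elim dvdE)
    then have "0 < k" "k \<le> 2" using that n0 by auto
    then have "k = 1 \<or> k = 2" by auto
    then show ?thesis using k by auto
  qed
  then have "{j. 0 < j \<and> j \<le> 2 * n \<and> n dvd j} = {n, 2 * n}" using n0 by auto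
  then have 2: "(\<Sum>x\<in>UNIV. (1 - x ^ 3) ^ (2 * n)) = (- of_nat (2 * n choose n) - 1 :: 'a)"
    using sum_one_minus_cube_power[of "2 * n"] m1 n0 by (simp add: power_mult)
  have "(of_nat (W 1) :: 'a) = (\<Sum>x\<in>UNIV. 1 + (1 - x ^ 3) ^ n + (1 - x ^ 3) ^ (2 * n))"
    unfolding W_eq of_nat_sum of_nat_card_cube_roots ..
  also have "\<dots> = of_nat CARD('a) - 1 - of_nat (2 * n choose n) - 1"
    by (simp only: sum.distrib 1 2) simp
  also have "of_nat CARD('a) = (0::'a)" using of_nat_q card_field by simp
  finally have "of_nat (W 1 + 2 + (2 * n choose n)) = (0::'a)" by simp
  then have "p dvd W 1 + 2 + (2 * n choose n)" by (simp only: of_nat_eq_0_iff_p)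
  then have A: "int p dvd int (W 1) + 2 + int (2 * n choose n)"
    by (metis int_dvd_int_iff of_nat_add of_nat_numeral)
  have B: "int p dvd int card_F" using of_nat_q by (simp only: of_nat_eq_0_iff_p int_dvd_int_iff)
  have "int p dvd c + int (2 * n choose n)"
    using dvd_diff[OF A B] by (simp add: c_def algebra_simps)
  then have "int p dvd c \<longleftrightarrow> int p dvd int (2 * n choose n)"
    by (metis dvd_add_left_iff dvd_add_right_iff)
  then show ?thesis by simp
qed

lemma spectrum_theta:
  "is_spectrum (adj_matrix (cayley3 :: 'a \<Rightarrow> 'a \<Rightarrow> bool))
    ({#real n#} + (\<Sum>t\<in>#{#\<theta> 1, \<theta> g, \<theta> (g\<^sup>2)#}. replicate_mset n ((of_int t - 1) / 3)))"
  using spectrum_multiset by (simp add: \<theta>_def add_ac)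

section \<open>Connectedness and strong regularity\<close>

text \<open>If one value of \<theta> were the field size q, the other two would sum to -q and the
  square sum \<open>6 * q\<close> would be at least \<open>3 * q\<^sup>2 / 2\<close>, forcing q to
  be at most 4. Connectedness rests on this separation of the degree from the other
  eigenvalues.\<close>

lemma h_neq_n: "b \<noteq> 0 \<Longrightarrow> h b \<noteq> int n"
proof
  assume b: "b \<noteq> 0" and "h b = int n"
  then have t: "\<theta> b = int card_F" by (simp add: \<theta>_def)
  have "\<theta> b \<in># image_mset \<theta> (mset_set (UNIV - {0}))" using b by auto
  also have "image_mset \<theta> (mset_set (UNIV - {0})) =
      replicate_mset n (\<theta> 1) + replicate_mset n (\<theta> g) + replicate_mset n (\<theta> (g\<^sup>2))"
    by (rule image_mset_coset_invariant) (rule theta_mult_cube)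
  finally have mem: "int card_F \<in> {\<theta> 1, \<theta> g, \<theta> (g\<^sup>2)}" using t by (auto split: if_splits)
  have aux: False if "x = int card_F" "x + y + z = 0" "x ^ 2 + y ^ 2 + z ^ 2 = 6 * int card_F" for x y z :: int
  proof -
    have z: "z = - int card_F - y" using that by simp
    have "2 * (y ^ 2 + z ^ 2) = (y - z)\<^sup>2 + (int card_F)\<^sup>2"
      unfolding z by (simp add: power2_eq_square algebra_simps)
    then have "(int card_F)\<^sup>2 \<le> 2 * (y ^ 2 + z ^ 2)" using zero_le_power2[of "y - z"] by linarith
    also have "\<dots> = 12 * int card_F - 2 * (int card_F)\<^sup>2" using that by simp
    finally have "int card_F * int card_F \<le> int card_F * 4" by (simp add: power2_eq_square)
    then have "int card_F \<le> 4" by (subst (asm) mult_le_cancel_left_pos) simp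
    then show False using n_gt_1 by simp
  qed
  show False
    using mem aux[of "\<theta> 1" "\<theta> g" "\<theta> (g\<^sup>2)"] aux[of "\<theta> g" "\<theta> 1" "\<theta> (g\<^sup>2)"] aux[of "\<theta> (g\<^sup>2)" "\<theta> 1" "\<theta> g"]
      theta_sum theta_sum_sq by (auto simp: add_ac)
qed

text \<open>The set \<open>S\<close> reachable from 0 is invariant under translation by cubes, so
  each Fourier coefficient of its indicator is scaled equally by \<open>\<eta> b\<close> and by
  \<open>n\<close>. For nonzero \<open>b\<close> these differ, so only the coefficient at 0
  survives.\<close>

lemma connected: "graph_connected (cayley3 :: 'a \<Rightarrow> 'a \<Rightarrow> bool)"
proof -
  define S where "S = {v::'a. cayley3\<^sup>*\<^sup>* 0 v}"
  have step: "v + r \<in> S" if "v \<in> S" "r \<in> R" for v r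
    using that by (auto simp: S_def cayley3_def intro: rtranclp.rtrancl_into_rtrancl)
  have F: "(\<Sum>u\<in>S. \<psi> (b * u)) = (if b = 0 then of_nat (card S) else 0)" for b
  proof (cases "b = 0")
    case True
    then show ?thesis by (simp add: psi_0)
  next
    case False
    have "\<psi> (b * r) * (\<Sum>u\<in>S. \<psi> (b * u)) = (\<Sum>u\<in>S. \<psi> (b * u))" if r: "r \<in> R" for r
    proof -
      have "(\<Sum>u\<in>S. \<psi> (b * u)) = (\<Sum>u\<in>S. \<psi> (b * (u + r)))"
        using step[OF _ r] step[of _ "- r"] r cubes_uminus[of r]
        by (intro sum.reindex_bij_witness[of _ "\<lambda>u. u + r" "\<lambda>u. u - r"]) (auto simp flip: diff_conv_add_uminus)
      also have "\<dots> = \<psi> (b * r) * (\<Sum>u\<in>S. \<psi> (b * u))"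
        unfolding sum_distrib_left by (intro sum.cong refl) (simp add: distrib_left psi_add)
      finally show ?thesis ..
    qed
    then have "(\<Sum>r\<in>R. \<psi> (b * r) * (\<Sum>u\<in>S. \<psi> (b * u))) = (\<Sum>r\<in>R. (\<Sum>u\<in>S. \<psi> (b * u)))"
      by (rule sum.cong[OF refl])
    then have "\<eta> b * (\<Sum>u\<in>S. \<psi> (b * u)) = of_nat n * (\<Sum>u\<in>S. \<psi> (b * u))"
      by (simp add: card_cubes \<eta>_def flip: sum_distrib_right)
    moreover have "\<eta> b \<noteq> of_nat n"
      using h_neq_n[OF False] unfolding eta_eq by (metis of_int_eq_iff of_int_of_nat_eq)
    ultimately show ?thesis using False by simp
  qed
  \<comment> \<open>Fourier inversion at the point 0 of \<open>S\<close>: one order of summation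
    gives \<open>card S\<close>, the other the field size.\<close>
  have "of_nat (card S) = (\<Sum>b\<in>UNIV. \<Sum>u\<in>S. \<psi> (b * u))" by (simp add: F)
  also have "\<dots> = (\<Sum>u\<in>S. \<Sum>b\<in>UNIV. \<psi> (b * u))" by (rule sum.swap)
  also have "\<dots> = (\<Sum>u\<in>S. if u = 0 then of_nat card_F else 0)" by (intro sum.cong refl sum_psi)
  also have "\<dots> = of_nat card_F" by (simp add: S_def)
  finally have "card S = CARD('a)" using card_field by (simp only: of_nat_eq_iff)
  then have "S = UNIV" by (intro card_subset_eq) auto
  then have 0: "cayley3\<^sup>*\<^sup>* 0 v" for v :: 'a by (auto simp: S_def)
  have "cayley3\<^sup>*\<^sup>* u (u + w)" for u w :: 'a
    using 0[of w]
  proof (induction rule: rtranclp_induct)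
    case (step y z)
    then have "cayley3 (u + y) (u + z)" by (simp add: cayley3_def)
    then show ?case using step.IH by (rule rtranclp.rtrancl_into_rtrancl[rotated])
  qed simp
  then have "cayley3\<^sup>*\<^sup>* u v" for u v :: 'a by (metis add_diff_cancel_left' diff_add_cancel add.commute)
  then show ?thesis by (simp add: graph_connected_def)
qed

text \<open>If \<open>h\<close> takes two values \<open>r, s\<close> away from 0, then \<open>h\<^sup>2 = (r + s) h - r s\<close> there, and Fourier
  inversion turns this into a formula for the number of common neighbours.\<close>

lemma strongly_regular_if_two_values:
  assumes two: "\<And>b. b \<noteq> 0 \<Longrightarrow> h b = r \<or> h b = s"
  shows "strongly_regular (cayley3 :: 'a \<Rightarrow> 'a \<Rightarrow> bool)"
proof -
  \<comment> \<open>This is \<open>(n - r) * (n - s)\<close>, the correction at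
    \<open>b = 0\<close>, where the period is \<open>n\<close> and the quadratic relation may
    fail.\<close>
  define K where "K = (int n)\<^sup>2 - (r + s) * int n + r * s"
  define N where "N d = card {x \<in> R. d - x \<in> R}" for d
  have eta_sq: "(\<Sum>b\<in>UNIV. \<eta> b * \<eta> b * \<psi> (b * - d)) = of_nat (card_F * N d)" for d
  proof -
    have "\<eta> b * \<eta> b * \<psi> (b * - d) = (\<Sum>x\<in>R. \<Sum>y\<in>R. \<psi> (b * (x + y - d)))" for b
      unfolding \<eta>_def sum_product unfolding sum_distrib_right
      by (intro sum.cong refl) (simp only: diff_conv_add_uminus distrib_left psi_add)
    then have "(\<Sum>b\<in>UNIV. \<eta> b * \<eta> b * \<psi> (b * - d)) = (\<Sum>b\<in>UNIV. \<Sum>x\<in>R. \<Sum>y\<in>R. \<psi> (b * (x + y - d)))" by simp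
    also have "\<dots> = (\<Sum>x\<in>R. \<Sum>b\<in>UNIV. \<Sum>y\<in>R. \<psi> (b * (x + y - d)))" by (rule sum.swap)
    also have "\<dots> = (\<Sum>x\<in>R. \<Sum>y\<in>R. \<Sum>b\<in>UNIV. \<psi> (b * (x + y - d)))"
      by (intro sum.cong refl sum.swap)
    also have "\<dots> = (\<Sum>x\<in>R. \<Sum>y\<in>R. if y = d - x then of_nat card_F else 0)"
      unfolding sum_psi by (intro sum.cong refl) (auto simp: algebra_simps)
    also have "\<dots> = (\<Sum>x\<in>R. if d - x \<in> R then of_nat card_F else 0)" by simp
    also have "\<dots> = (\<Sum>x\<in>{x \<in> R. d - x \<in> R}. of_nat card_F)"
      by (intro sum.mono_neutral_cong_right) auto
    finally show ?thesis by (simp add: N_def algebra_simps)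
  qed
  have eta_lin: "(\<Sum>b\<in>UNIV. \<eta> b * \<psi> (b * - d)) = of_nat (card_F * (if d \<in> R then 1 else 0))" for d
  proof -
    have "\<eta> b * \<psi> (b * - d) = (\<Sum>x\<in>R. \<psi> (b * (x - d)))" for b
      unfolding \<eta>_def sum_distrib_right
      by (intro sum.cong refl) (simp only: diff_conv_add_uminus distrib_left psi_add)
    then have "(\<Sum>b\<in>UNIV. \<eta> b * \<psi> (b * - d)) = (\<Sum>b\<in>UNIV. \<Sum>x\<in>R. \<psi> (b * (x - d)))" by simp
    also have "\<dots> = (\<Sum>x\<in>R. \<Sum>b\<in>UNIV. \<psi> (b * (x - d)))" by (rule sum.swap)
    also have "\<dots> = (\<Sum>x\<in>R. if x = d then of_nat card_F else 0)"
      unfolding sum_psi by simp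
    finally show ?thesis by simp
  qed
  have N: "int card_F * int (N d) = K + (r + s) * int card_F * (if d \<in> R then 1 else 0)" if d: "d \<noteq> 0" for d
  proof -
    have pt: "\<eta> b * \<eta> b * \<psi> (b * - d) = (if b = 0 then of_int K else 0)
        + of_int (r + s) * (\<eta> b * \<psi> (b * - d)) - of_int (r * s) * \<psi> (b * - d)" for b
    proof (cases "b = 0")
      case True
      then show ?thesis by (simp add: eta_0 psi_0 K_def power2_eq_square algebra_simps)
    next
      case False
      then have "h b * h b = (r + s) * h b - r * s" using two[OF False] by (auto simp: algebra_simps)
      then have "\<eta> b * \<eta> b = of_int (r + s) * \<eta> b - of_int (r * s)"
        unfolding eta_eq by (metis of_int_diff of_int_mult)
      then show ?thesis using False by (simp add: left_diff_distrib mult.assoc)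
    qed
    have "of_nat (card_F * N d) = (\<Sum>b\<in>UNIV. (if b = (0::'a) then of_int K else 0)
        + of_int (r + s) * (\<eta> b * \<psi> (b * - d)) - of_int (r * s) * \<psi> (b * - d))"
      unfolding eta_sq[symmetric] pt ..
    also have "\<dots> = of_int K + of_int (r + s) * (\<Sum>b\<in>UNIV. \<eta> b * \<psi> (b * - d))
        - of_int (r * s) * (\<Sum>b\<in>UNIV. \<psi> (b * - d))"
      unfolding sum_subtractf sum.distrib sum_distrib_left by simp
    also have "\<dots> = of_int (K + (r + s) * int card_F * (if d \<in> R then 1 else 0))"
      unfolding eta_lin sum_psi using d by simp
    finally have "complex_of_int (int (card_F * N d)) = of_int (K + (r + s) * int card_F * (if d \<in> R then 1 else 0))"
      by (simp only: of_int_of_nat_eq)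
    then show ?thesis by (simp only: of_int_eq_iff of_nat_mult)
  qed
  have common: "card {w. cayley3 u w \<and> cayley3 v w} = N (v - u)" for u v
  proof -
    have "bij_betw (\<lambda>w. w - u) {w. cayley3 u w \<and> cayley3 v w} {x \<in> R. v - u - x \<in> R}"
    proof (rule bij_betw_byWitness[where f' = "\<lambda>x. u + x"])
      have "v - u - (w - u) \<in> R \<longleftrightarrow> w - v \<in> R" for w
        using cubes_uminus[of "w - v"] by simp
      then show "(\<lambda>w. w - u) ` {w. cayley3 u w \<and> cayley3 v w} \<subseteq> {x \<in> R. v - u - x \<in> R}"
        unfolding cayley3_def by blast
      have "u + x - v \<in> R \<longleftrightarrow> v - u - x \<in> R" for x
        using cubes_uminus[of "u + x - v"] by (simp add: algebra_simps)
      then show "(\<lambda>x. u + x) ` {x \<in> R. v - u - x \<in> R} \<subseteq> {w. cayley3 u w \<and> cayley3 v w}"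
        unfolding cayley3_def by auto
    qed auto
    then show ?thesis unfolding N_def by (rule bij_betw_same_card)
  qed
  \<comment> \<open>The division is exact, so the count is determined independently of
    \<open>d\<close>; the same holds for nonneighbours.\<close>
  have adj: "N d = nat ((K + (r + s) * int card_F) div int card_F)" if "d \<in> R" for d
  proof -
    have "d \<noteq> 0" using that zero_notin_cubes by auto
    then have "K + (r + s) * int card_F = int card_F * int (N d)" using N[of d] that by simp
    then show ?thesis by simp
  qed
  have nonadj: "N d = nat (K div int card_F)" if "d \<noteq> 0" "d \<notin> R" for d
  proof -
    have "K = int card_F * int (N d)" using N[of d] that by simp
    then show ?thesis by simp
  qed
  have deg: "card {w. cayley3 u w} = n" for u :: 'a
  proof -
    have "bij_betw (\<lambda>w. w - u) {w. cayley3 u w} R"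
      by (rule bij_betw_byWitness[where f' = "\<lambda>x. u + x"]) (auto simp: cayley3_def)
    then show ?thesis using bij_betw_same_card card_cubes by metis
  qed
  have sym: "cayley3 u v \<longleftrightarrow> cayley3 v u" for u v :: 'a
    unfolding cayley3_def using cubes_uminus[of "v - u"] by simp
  have irrefl: "\<not> cayley3 u u" for u :: 'a
    using zero_notin_cubes by (simp add: cayley3_def)
  have adj': "card {w. cayley3 u w \<and> cayley3 v w} = nat ((K + (r + s) * int card_F) div int card_F)"
    if "cayley3 u v" for u v :: 'a
    using adj[of "v - u"] that unfolding common by (simp add: cayley3_def)
  have nonadj': "card {w. cayley3 u w \<and> cayley3 v w} = nat (K div int card_F)"
    if "u \<noteq> v" "\<not> cayley3 u v" for u v :: 'a
    using nonadj[of "v - u"] that unfolding common by (simp add: cayley3_def)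
  show ?thesis
    unfolding strongly_regular_def using sym irrefl deg adj' nonadj' by blast
qed

end

section \<open>The spectrum of the cubic Cayley graph\<close>

lemma (in cubic_field) p_power_m: "int card_F = int p ^ m"
  using card_field card_prime_power by (metis of_nat_power)

text \<open>As \<open>c\<close> is prime to \<open>p\<close>, the descent removes exactly p^t from
  each value and leaves cofactors with product \<open>c\<close>. Since p^t is 1 modulo 3, they keep
  the residue 1 that \<open>split_triple\<close> requires.\<close>

lemma (in cubic_field) split_spectrum:
  assumes p3: "p mod 3 = 1" and m: "m = 3 * t"
  shows "\<exists>a b::int. 4 * int p ^ t = a\<^sup>2 + 27 * b\<^sup>2 \<and> a mod 3 = 1 \<and> \<not> int p dvd a \<and>
    is_spectrum (adj_matrix (cayley3 :: 'a \<Rightarrow> 'a \<Rightarrow> bool))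
      ({#real n#} + replicate_mset n ((of_int a * real p ^ t - 1) / 3)
       + replicate_mset n ((- (1/2) * of_int (a + 9 * b) * real p ^ t - 1) / 3)
       + replicate_mset n ((- (1/2) * of_int (a - 9 * b) * real p ^ t - 1) / 3))"
proof -
  let ?x = "\<theta> 1" and ?y = "\<theta> g" and ?z = "\<theta> (g\<^sup>2)"
  have t: "t > 0" using m card_field card_prime_power n_gt_1 by (cases t) auto
  have "n = (p ^ m - 1) div 3" using card_field card_prime_power by simp
  then have pc: "\<not> int p dvd c"
    using dvd_c_iff not_prime_dvd_central_binomial[OF prime_p p3, of m] by simp
  have q: "int card_F = int p ^ (t + 2 * t)" "int card_F = int p ^ (3 * t)" using p_power_m m by simp_all
  have z: "?z = - ?x - ?y" using theta_sum by simp
  have "2 * (?x * ?y + ?y * ?z + ?z * ?x) = - (?x ^ 2 + ?y ^ 2 + ?z ^ 2)"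
    unfolding z by (simp add: power2_eq_square algebra_simps)
  then have e2: "?x * ?y + ?y * ?z + ?z * ?x = - 3 * int p ^ (t + 2 * t)"
    using theta_sum_sq unfolding q(1) by simp
  have e3: "?x * ?y * ?z = int p ^ (3 * t) * c" using theta_prod q(2) by simp
  have "prime (int p)" using prime_p by simp
  from split_triple_descent[OF this t theta_sum e2 e3] obtain x y z where
    xyz: "?x = int p ^ t * x" "?y = int p ^ t * y" "?z = int p ^ t * z"
    and s: "x + y + z = 0" "x * y + y * z + z * x = - 3 * int p ^ t" "x * y * z = c" by blast
  have "[int p = 1] (mod 3)" using p3 zmod_int[of p 3] by (simp add: cong_def)
  then have "[int p ^ t = 1 ^ t] (mod 3)" by (rule cong_pow)
  then have "[int p ^ t * k = 1 * k] (mod 3)" for k by (intro cong_mult) auto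
  then have red: "k mod 3 = 1" if "(int p ^ t * k) mod 3 = 1" for k using that by (simp add: cong_def)
  have mod3: "x mod 3 = 1" "y mod 3 = 1" "z mod 3 = 1"
    using red theta_mod_3 xyz by metis+
  from split_triple[OF s(1,2) mod3] obtain a b u v where
    abuv: "{#x, y, z#} = {#a, u, v#}" "2 * u = - (a + 9 * b)" "2 * v = - (a - 9 * b)"
      "4 * int p ^ t = a\<^sup>2 + 27 * b\<^sup>2" by blast
  have "a \<in># {#x, y, z#}" unfolding abuv(1) by simp
  then have a: "a = x \<or> a = y \<or> a = z" by auto
  then have a3: "a mod 3 = 1" using mod3 by blast
  \<comment> \<open>\<open>a\<close> is one of the three factors of \<open>c\<close>.\<close>
  have pa: "\<not> int p dvd a" using a pc s(3) by (metis dvd_mult dvd_mult2)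
  have "{#?x, ?y, ?z#} = image_mset ((*) (int p ^ t)) {#a, u, v#}"
    unfolding abuv(1)[symmetric] xyz by simp
  then have spec: "is_spectrum (adj_matrix (cayley3 :: 'a \<Rightarrow> 'a \<Rightarrow> bool))
    ({#real n#} + (\<Sum>t\<in>#image_mset ((*) (int p ^ t)) {#a, u, v#}. replicate_mset n ((of_int t - 1) / 3)))"
    using spectrum_theta by simp
  have "real_of_int u = - (1/2) * of_int (a + 9 * b)" "real_of_int v = - (1/2) * of_int (a - 9 * b)"
  proof -
    have "real_of_int (2 * u) = of_int (- (a + 9 * b))" "real_of_int (2 * v) = of_int (- (a - 9 * b))"
      using abuv(2,3) by simp_all
    then show "real_of_int u = - (1/2) * of_int (a + 9 * b)" "real_of_int v = - (1/2) * of_int (a - 9 * b)"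
      by (simp_all add: field_simps)
  qed
  then have sum: "(\<Sum>t\<in>#image_mset ((*) (int p ^ t)) {#a, u, v#}. replicate_mset n ((real_of_int t - 1) / 3)) =
      replicate_mset n ((of_int a * real p ^ t - 1) / 3)
       + replicate_mset n ((- (1/2) * of_int (a + 9 * b) * real p ^ t - 1) / 3)
       + replicate_mset n ((- (1/2) * of_int (a - 9 * b) * real p ^ t - 1) / 3)"
    by (simp add: mult.commute)
  have "is_spectrum (adj_matrix (cayley3 :: 'a \<Rightarrow> 'a \<Rightarrow> bool))
      ({#real n#} + replicate_mset n ((of_int a * real p ^ t - 1) / 3)
       + replicate_mset n ((- (1/2) * of_int (a + 9 * b) * real p ^ t - 1) / 3)
       + replicate_mset n ((- (1/2) * of_int (a - 9 * b) * real p ^ t - 1) / 3))"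
    using spec unfolding sum by (simp only: add.assoc)
  with abuv(4) a3 pa show ?thesis by blast
qed

lemma (in cubic_field) inert_thetas:
  assumes "p mod 3 = 2" "m = 2 * t"
  shows "{#\<theta> 1, \<theta> g, \<theta> (g\<^sup>2)#} = image_mset (\<lambda>u. (- 1) ^ t * int p ^ t * u) {#1, 1, -2#}"
  using inert_triple[OF prime_p assms(1) theta_sum _ theta_mod_3 theta_mod_3 theta_mod_3, of t]
    theta_sum_sq p_power_m assms(2) by simp

text \<open>The sign \<open>(- 1) ^ t\<close> treats both residues of \<open>m\<close> modulo 4 at
  once; the repeated entry 1 of the triple accounts for the multiplicity
  \<open>2 * n\<close>.\<close>

lemma (in cubic_field) inert_spectrum:
  assumes "p mod 3 = 2" "m = 2 * t"
  shows "is_spectrum (adj_matrix (cayley3 :: 'a \<Rightarrow> 'a \<Rightarrow> bool))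
    ({#real n#} + replicate_mset (2 * n) (((- 1) ^ t * real p ^ t - 1) / 3)
      + replicate_mset n ((- 2 * (- 1) ^ t * real p ^ t - 1) / 3))"
proof -
  have "replicate_mset (2 * n) r = replicate_mset n r + replicate_mset n r" for r :: real
    by (simp add: mult_2 multiset_eq_iff)
  then show ?thesis
    using spectrum_theta unfolding inert_thetas[OF assms] by (simp add: add_ac mult_ac)
qed

lemma (in cubic_field) inert_strongly_regular:
  assumes "p mod 3 = 2" "m = 2 * t"
  shows "strongly_regular (cayley3 :: 'a \<Rightarrow> 'a \<Rightarrow> bool)"
proof (rule strongly_regular_if_two_values)
  fix b :: 'a assume "b \<noteq> 0"
  define e where "e = (- 1) ^ t * int p ^ t"
  have "\<theta> b \<in># image_mset \<theta> (mset_set (UNIV - {0}))" using \<open>b \<noteq> 0\<close> by auto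
  also have "image_mset \<theta> (mset_set (UNIV - {0})) =
      replicate_mset n (\<theta> 1) + replicate_mset n (\<theta> g) + replicate_mset n (\<theta> (g\<^sup>2))"
    by (rule image_mset_coset_invariant) (rule theta_mult_cube)
  finally have "\<theta> b \<in># {#\<theta> 1, \<theta> g, \<theta> (g\<^sup>2)#}" by (auto split: if_splits)
  then have "\<theta> b = e \<or> \<theta> b = - 2 * e" unfolding inert_thetas[OF assms] by (auto simp: e_def)
  moreover have "h b = (\<theta> b - 1) div 3" by (simp add: \<theta>_def)
  ultimately show "h b = (e - 1) div 3 \<or> h b = (- 2 * e - 1) div 3" by auto
qed

lemma power_eq_geometric_sum:
  fixes p m :: nat
  assumes "p > 0"
  shows "p ^ m = (p - 1) * (\<Sum>i<m. p ^ i) + 1"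
proof (induction m)
  case (Suc m)
  have "p ^ Suc m = (p - 1) * p ^ m + p ^ m"
    using assms by (cases p) auto
  also have "\<dots> = (p - 1) * p ^ m + ((p - 1) * (\<Sum>i<m. p ^ i) + 1)" using Suc by simp
  also have "\<dots> = (p - 1) * (\<Sum>i<Suc m. p ^ i) + 1" by (simp add: distrib_left)
  finally show ?case .
qed simp

lemma int_coprime_prime_iff: "prime p \<Longrightarrow> coprime a (int p) \<longleftrightarrow> \<not> int p dvd a"
proof
  assume p: "prime p"
  show "coprime a (int p) \<Longrightarrow> \<not> int p dvd a"
    using p coprime_common_divisor[of a "int p" "int p"] by auto
  show "\<not> int p dvd a \<Longrightarrow> coprime a (int p)"
    using p prime_imp_coprime[of "int p" a] by (simp add: coprime_commute)
qed

theorem theorem6p1: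
  fixes p m :: nat
  assumes "prime p"
    and "CARD('a::{field,finite}) = p ^ m"
    and "3 dvd ((p ^ m - 1) div (p - 1))"
    and "p ^ m \<ge> 5"
  defines "q \<equiv> p ^ m" and "n \<equiv> (p ^ m - 1) div 3"
  shows "graph_connected (cayley3 :: 'a \<Rightarrow> 'a \<Rightarrow> bool)
    \<and> (\<exists>M. is_spectrum (adj_matrix (cayley3 :: 'a \<Rightarrow> 'a \<Rightarrow> bool)) M \<and> (\<forall>x\<in>#M. x \<in> \<int>))
    \<and> (p mod 3 = 1 \<longrightarrow>
         (\<exists>t. m = 3 * t) \<and>
         (\<exists>a b::int. 4 * root 3 (real q) = of_int (a^2 + 27 * b^2) \<and> a mod 3 = 1 \<and> coprime a (int p)) \<and>
         (\<forall>a b a' b'::int. 4 * root 3 (real q) = of_int (a^2 + 27 * b^2) \<and> a mod 3 = 1 \<and> coprime a (int p)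
             \<and> 4 * root 3 (real q) = of_int (a'^2 + 27 * b'^2) \<and> a' mod 3 = 1 \<and> coprime a' (int p)
             \<longrightarrow> a = a' \<and> \<bar>b\<bar> = \<bar>b'\<bar>) \<and>
         (\<forall>a b::int. 4 * root 3 (real q) = of_int (a^2 + 27 * b^2) \<and> a mod 3 = 1 \<and> coprime a (int p) \<longrightarrow>
            is_spectrum (adj_matrix (cayley3 :: 'a \<Rightarrow> 'a \<Rightarrow> bool))
              ({# real n #}
               + replicate_mset n ((a * root 3 (real q) - 1) / 3)
               + replicate_mset n ((- (1/2) * (a + 9 * b) * root 3 (real q) - 1) / 3)
               + replicate_mset n ((- (1/2) * (a - 9 * b) * root 3 (real q) - 1) / 3))))
    \<and> (p mod 3 = 2 \<longrightarrow>
         (\<exists>t. m = 2 * t) \<and>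
         (m mod 4 = 0 \<longrightarrow>
            is_spectrum (adj_matrix (cayley3 :: 'a \<Rightarrow> 'a \<Rightarrow> bool))
              ({# real n #}
               + replicate_mset (2 * n) ((sqrt (real q) - 1) / 3)
               + replicate_mset n ((- 2 * sqrt (real q) - 1) / 3))) \<and>
         (m mod 4 = 2 \<longrightarrow>
            is_spectrum (adj_matrix (cayley3 :: 'a \<Rightarrow> 'a \<Rightarrow> bool))
              ({# real n #}
               + replicate_mset n ((2 * sqrt (real q) - 1) / 3)
               + replicate_mset (2 * n) ((- sqrt (real q) - 1) / 3))) \<and>
         strongly_regular (cayley3 :: 'a \<Rightarrow> 'a \<Rightarrow> bool))"
proof -
  have p1: "p > 1" using assms(1) prime_gt_1_nat by blast
  \<comment> \<open>\<open>s\<close> is (q - 1)/(p - 1). Being divisible by 3, it makes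
    \<open>n\<close> the multiple \<open>(p - 1) * j\<close> of \<open>p - 1\<close>.\<close>
  define s where "s = (\<Sum>i<m. p ^ i)"
  have qs: "p ^ m = (p - 1) * s + 1" using power_eq_geometric_sum p1 by (simp add: s_def)
  then have "(p ^ m - 1) div (p - 1) = s" using p1 by simp
  then have "3 dvd s" using assms(3) by simp
  then obtain j where j: "s = 3 * j" by (elim dvdE)
  have nj: "n = (p - 1) * j" using qs j by (simp add: n_def)
  have qn: "p ^ m = 3 * n + 1" using qs j nj by simp
  obtain T :: "'a \<Rightarrow> nat" where "\<forall>x. T x < p" "\<forall>x y. T (x + y) = (T x + T y) mod p" "\<exists>x. T x \<noteq> 0"
    using ex_additive_functional[OF assms(1,2)] by blast
  then interpret cubic_field p m n T
    using assms(1,2,4) qn nj by unfold_locales auto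
  have spec: "is_spectrum (adj_matrix (cayley3 :: 'a \<Rightarrow> 'a \<Rightarrow> bool))
    ({#real n#} + replicate_mset n (of_int (h 1)) + replicate_mset n (of_int (h g))
      + replicate_mset n (of_int (h (g\<^sup>2))))" by (rule spectrum_multiset)
  have "\<forall>x\<in>#({#real n#} + replicate_mset n (of_int (h 1)) + replicate_mset n (of_int (h g))
      + replicate_mset n (of_int (h (g\<^sup>2)))). x \<in> \<int>"
    by (auto simp: in_replicate_mset)
  with spec have integral: "\<exists>M. is_spectrum (adj_matrix (cayley3 :: 'a \<Rightarrow> 'a \<Rightarrow> bool)) M \<and> (\<forall>x\<in>#M. x \<in> \<int>)"
    by blast
  let ?A = "adj_matrix (cayley3 :: 'a \<Rightarrow> 'a \<Rightarrow> bool)"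
  let ?rep = "\<lambda>a b::int. 4 * root 3 (real q) = of_int (a^2 + 27 * b^2) \<and> a mod 3 = 1 \<and> coprime a (int p)"
  let ?M = "\<lambda>a b::int. {# real n #}
               + replicate_mset n ((a * root 3 (real q) - 1) / 3)
               + replicate_mset n ((- (1/2) * of_int (a + 9 * b) * root 3 (real q) - 1) / 3)
               + replicate_mset n ((- (1/2) * of_int (a - 9 * b) * root 3 (real q) - 1) / 3)"
  have split: "(\<exists>t. m = 3 * t) \<and> (\<exists>a b. ?rep a b) \<and>
      (\<forall>a b a' b'. 4 * root 3 (real q) = of_int (a^2 + 27 * b^2) \<and> a mod 3 = 1 \<and> coprime a (int p)
         \<and> ?rep a' b' \<longrightarrow> a = a' \<and> \<bar>b\<bar> = \<bar>b'\<bar>) \<and>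
      (\<forall>a b. ?rep a b \<longrightarrow> is_spectrum ?A (?M a b))" if p3: "p mod 3 = 1"
  proof -
    \<comment> \<open>Each of the \<open>m\<close> terms of \<open>s\<close> is 1 modulo 3, so
      \<open>s\<close> is congruent to \<open>m\<close>.\<close>
    have "[s = (\<Sum>i<m. 1 ^ i)] (mod 3)"
      unfolding s_def by (intro cong_sum cong_pow) (simp add: cong_def p3)
    then have "3 dvd m" using \<open>3 dvd s\<close> by (simp add: cong_dvd_iff)
    then obtain t where m: "m = 3 * t" by (elim dvdE)
    have t: "t > 0" using m assms(4) by (cases t) auto
    have "real q = (real p ^ t) ^ 3" by (simp add: q_def m mult.commute flip: power_mult)
    then have root: "root 3 (real q) = real p ^ t" by (simp add: real_root_power_cancel)
    have "4 * root 3 (real q) = of_int (a^2 + 27 * b^2) \<longleftrightarrow> 4 * int p ^ t = a\<^sup>2 + 27 * b\<^sup>2" for a b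
    proof -
      have "4 * root 3 (real q) = of_int (4 * int p ^ t)" by (simp add: root)
      then show ?thesis by (simp only: of_int_eq_iff)
    qed
    then have rep: "?rep a b \<longleftrightarrow> 4 * int p ^ t = a\<^sup>2 + 27 * b\<^sup>2 \<and> a mod 3 = 1 \<and> \<not> int p dvd a" for a b
      using int_coprime_prime_iff[OF assms(1)] by blast
    have uniq: "a = a' \<and> \<bar>b\<bar> = \<bar>b'\<bar>" if "?rep a b" "?rep a' b'" for a b a' b'
      using represent_unique[OF assms(1) p3 t] that unfolding rep by blast
    obtain a b where "4 * int p ^ t = a\<^sup>2 + 27 * b\<^sup>2 \<and> a mod 3 = 1 \<and> \<not> int p dvd a"
      and sp: "is_spectrum ?A (?M a b)"
      using split_spectrum[OF p3 m] unfolding root by blast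
    then have ab: "?rep a b" unfolding rep by blast
    have "is_spectrum ?A (?M a' b')" if r: "?rep a' b'" for a' b'
    proof -
      \<comment> \<open>Changing the sign of \<open>b\<close> only swaps the last two eigenvalues,
        so every admissible pair gives the same multiset.\<close>
      have "a' = a" "b' = b \<or> b' = - b" using uniq[OF r ab] by auto
      then have "?M a' b' = ?M a b" by (auto simp: add_ac)
      then show ?thesis using sp by simp
    qed
    then show ?thesis using m ab uniq by blast
  qed
  have inert: "(\<exists>t. m = 2 * t) \<and>
         (m mod 4 = 0 \<longrightarrow> is_spectrum ?A ({# real n #}
               + replicate_mset (2 * n) ((sqrt (real q) - 1) / 3)
               + replicate_mset n ((- 2 * sqrt (real q) - 1) / 3))) \<and>
         (m mod 4 = 2 \<longrightarrow> is_spectrum ?A ({# real n #}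
               + replicate_mset n ((2 * sqrt (real q) - 1) / 3)
               + replicate_mset (2 * n) ((- sqrt (real q) - 1) / 3))) \<and>
         strongly_regular (cayley3 :: 'a \<Rightarrow> 'a \<Rightarrow> bool)" if p3: "p mod 3 = 2"
  proof -
    \<comment> \<open>For odd \<open>m\<close> the power \<open>p ^ m\<close> would be 2 modulo 3,
      against \<open>qn\<close>.\<close>
    have "even m"
    proof (rule ccontr)
      assume "odd m"
      then obtain k where k: "m = 2 * k + 1" by (elim oddE)
      have "p ^ m mod 3 = 2 ^ m mod 3" using p3 by (metis power_mod)
      also have "(2::nat) ^ m = 4 ^ k * 2" by (simp add: k power_mult)
      also have "\<dots> mod 3 = (4 mod 3) ^ k * 2 mod 3" by (metis mod_mult_left_eq power_mod)
      finally show False using qn by simp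
    qed
    then obtain t where m: "m = 2 * t" by (elim evenE)
    have "real q = (real p ^ t)\<^sup>2" by (simp add: q_def m mult.commute flip: power_mult)
    then have root: "sqrt (real q) = real p ^ t" by simp
    \<comment> \<open>The parity of \<open>t\<close> decides the sign \<open>(- 1) ^ t\<close>,
      which separates the two cases.\<close>
    have "even t" if "m mod 4 = 0" using that m by presburger
    moreover have "odd t" if "m mod 4 = 2" using that m by presburger
    ultimately show ?thesis
      using inert_spectrum[OF p3 m] inert_strongly_regular[OF p3 m] m
      unfolding root by (auto simp: add_ac)
  qed
  show ?thesis
    by (rule conjI[OF connected conjI[OF integral conjI[OF impI[OF split] impI[OF inert]]]])
qed

end
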